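(* Let $d=2$. Fix $\kappa\ge4$ an even integer, and fix an odd integer $j$ with $1\le j\le\lfloor\kappa/2\rfloor$. There is a sequence $\{\mathcal{F}_n\}_{n=1}^\infty$, which depends on $\kappa$, such that $\{\mathcal{F}_n\}\subset\big(\cos(j\pi/\kappa)\cos((j+1)\pi/\kappa),\ \cos((j-1)\pi/\kappa)\cos((j+1)\pi/\kappa)\big)\cap\boldsymbol{\Theta}_\kappa(D)$ and $\mathcal{F}_n<\mathcal{F}_{n+1}<\mathcal{F}_{n+2}$ for all $n\ge1$. Also $\mathcal{F}_{2n-1},\mathcal{F}_{2n}\in\boldsymbol{\Theta}_{n,\kappa}(D)$ for all $n\ge1$, and for each $n\ge1$ there are real numbers $X_0,\ldots,X_{n+1}$ solving, with $\mathcal{F}_n$, the system $(\Sigma_n)$ of the context and satisfying $$\cos((j+1)\pi/\kappa)=:X_{n+1}<X_n<\cdots<X_1<X_0<\cos((j-1)\pi/\kappa).$$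
   Context: Operators. For $d \geq 1$ let $\mathscr{H}=\ell^2(\mathbb{Z}^d)$, let $S_i$ be the shift $(S_i^{\pm 1} u)(n) = u(n_1,\ldots,n_i \mp 1,\ldots,n_d)$, $\Delta_i = \frac12 (S_i + S_i^* )$ and $D=D[d] = \prod_{i=1}^d \Delta_i$ (Molchanov--Vainberg Laplacian); $\sigma(D)=[-1,1]$. Let $(N_i u)(n) = n_i u(n)$. For $p,\kappa \in \mathbb{N}^*=\{1,2,\ldots\}$ let $A_i(p,\kappa)$ be the closure of $\frac{1}{4\mathrm{i}}\left[(S_i^{p\kappa}-S_i^{-p\kappa})N_i + N_i (S_i^{p\kappa}-S_i^{-p\kappa})\right]$ defined on compactly supported sequences, and $A_{p\kappa} = \sum_{i=1}^d A_i(p,\kappa)$ (self-adjoint). Thresholds. $\boldsymbol{\mu}_\kappa(D)$ is the set of $E \in \sigma(D)$ for which there exist a self-adjoint linear combination (finite or infinite) $\mathbb{A} = \sum_{p \geq 1} \rho_{p\kappa} A_{p\kappa}$, $\rho_{p\kappa}\in\mathbb{R}$, an interval $I \ni E$ and $\gamma>0$ with $1_I(D)[D,\mathrm{i}\mathbb{A}]_\circ 1_I(D) \geq \gamma 1_I(D)$, where $1_I(D)$ is the spectral projection of $D$ on $I$ and $[D,\mathrm{i}\mathbb{A}]_\circ$ is the bounded extension of the commutator from compactly supported sequences. $\boldsymbol{\Theta}_\kappa(D) = \sigma(D)\setminus \boldsymbol{\mu}_\kappa(D)$. Let $T_n,U_n$ be the Chebyshev polynomials of the first and second kind, $T_n(\cos\theta)=\cos(n\theta)$,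 $U_{n-1}(\cos\theta)=\sin(n\theta)/\sin\theta$. For $\vec{x}\in[-1,1]^d$ let $g_{p\kappa}(\vec{x}) = \sum_{i=1}^d \big(\prod_{l \neq i} x_l\big)(1-x_i^2)U_{p\kappa-1}(x_i)$, and $S_E = \{\vec{x}\in[-1,1]^d : \prod_{l=1}^d x_l = E\}$. The function $G_\kappa = \sum_p \rho_{p\kappa} g_{p\kappa}$ represents $[D,\mathrm{i}\mathbb{A}]_\circ$ by functional calculus (with $\Delta_i \leftrightarrow x_i$), and by continuity of $G_\kappa$, $E\in\boldsymbol{\mu}_\kappa(D)$ iff $G_\kappa>0$ on $S_E$ for some such $\mathbb{A}$. For $m\in\mathbb{N}^*$, $\boldsymbol{\Theta}_{m,\kappa}(D)$ is the set of $E\in[-1,1]$ such that there are $\vec{x}_0,\ldots,\vec{x}_m \in S_E$ and real numbers $\omega_0,\ldots,\omega_{m-1}\leq 0$ with $g_{p\kappa}(\vec{x}_m) = \sum_{q=0}^{m-1}\omega_q\, g_{p\kappa}(\vec{x}_q)$ for all $p\in\mathbb{N}^*$. System $(\Sigma_n)$ in the unknowns $\mathcal{F}_n,X_0,\ldots,X_{n+1}$: if $n$ is odd, $T_\kappa(X_q)=T_\kappa(X_{n-q})$ for $0\le q\le(n-1)/2$ and $X_{n-q}=\mathcal{F}_n/X_{1+q}$ for $-1\le q\le(n-1)/2$; if $n$ is even, $T_\kappa(X_q)=T_\kappa(X_{n-q})$ for $0\le q\le n/2-1$ and $X_{n-q}=\mathcal{F}_n/X_{1+q}$ for $-1\le q\le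 n/2-1$.
   Formalization: The formal theorem additionally assumes that the open interval is nonempty, i.e. cos((j+1)π/κ) > 0, equivalently 2(j+1) < κ; for j = κ/2 − 1 (e.g. κ=4, j=1) and j = κ/2 the interval is empty and the statement as printed is false. *)

theory Defs
  imports "HOL-Analysis.Analysis"
begin

section \<open>The Hilbert space of square-summable sequences on the lattice\<close>

text \<open>Operators are functions on all lattice functions; only their values on \<open>ell2\<close>
  (or on \<open>ell_c\<close>, the compactly supported sequences) matter.\<close>

type_synonym 'd lseq = "int ^ 'd \<Rightarrow> complex"

definition ell2 :: "('d::finite lseq) set" where
  "ell2 = {u. (\<lambda>n. (cmod (u n))\<^sup>2) summable_on UNIV}"

definition ell_c :: "('d::finite lseq) set" where
  "ell_c = {u. finite {n. u n \<noteq> 0}}"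

definition ip :: "'d::finite lseq \<Rightarrow> 'd lseq \<Rightarrow> complex" where
  "ip u v = (\<Sum>\<^sub>\<infinity>n. cnj (u n) * v n)"

definition l2norm :: "'d::finite lseq \<Rightarrow> real" where
  "l2norm u = sqrt (\<Sum>\<^sub>\<infinity>n. (cmod (u n))\<^sup>2)"

definition bounded_op :: "('d::finite lseq \<Rightarrow> 'd lseq) \<Rightarrow> bool" where
  "bounded_op T \<longleftrightarrow>
     (\<forall>u\<in>ell2. T u \<in> ell2) \<and>
     (\<forall>u\<in>ell2. \<forall>v\<in>ell2. \<forall>c. T (\<lambda>n. u n + c * v n) = (\<lambda>n. T u n + c * T v n)) \<and>
     (\<exists>C. \<forall>u\<in>ell2. l2norm (T u) \<le> C * l2norm u)"

text \<open>Real points of the spectrum (for a self-adjoint operator, the whole spectrum).\<close>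

definition real_spectrum :: "('d::finite lseq \<Rightarrow> 'd lseq) \<Rightarrow> real set" where
  "real_spectrum T =
     {E. \<not> (\<exists>R. bounded_op R \<and>
            (\<forall>u\<in>ell2. R (\<lambda>n. T u n - of_real E * u n) = u \<and>
                      (\<lambda>n. T (R u) n - of_real E * R u n) = u))}"

subsection \<open>Spectral projections\<close>

definition orth_projection :: "('d::finite lseq \<Rightarrow> 'd lseq) \<Rightarrow> bool" where
  "orth_projection Q \<longleftrightarrow>
     bounded_op Q \<and> (\<forall>u\<in>ell2. Q (Q u) = Q u) \<and>
     (\<forall>u\<in>ell2. \<forall>v\<in>ell2. ip (Q u) v = ip u (Q v))"

definition bounded_pvm :: "(real set \<Rightarrow> 'd::finite lseq \<Rightarrow> 'd lseq) \<Rightarrow> bool" where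
  "bounded_pvm P \<longleftrightarrow>
     (\<forall>B\<in>sets borel. orth_projection (P B)) \<and>
     (\<forall>u\<in>ell2. P {} u = (\<lambda>n. 0)) \<and>
     (\<exists>R. \<forall>u\<in>ell2. P {-R<..<R} u = u) \<and>
     (\<forall>B\<in>sets borel. \<forall>B'\<in>sets borel. \<forall>u\<in>ell2. P (B \<inter> B') u = P B (P B' u)) \<and>
     (\<forall>B::nat \<Rightarrow> real set. range B \<subseteq> sets borel \<longrightarrow> disjoint_family B \<longrightarrow>
        (\<forall>u\<in>ell2. (\<lambda>N. l2norm (\<lambda>n. P (\<Union>i. B i) u n - (\<Sum>i<N. P (B i) u n))) \<longlonglongrightarrow> 0))"

definition spectral_meas ::
    "(real set \<Rightarrow> 'd::finite lseq \<Rightarrow> 'd lseq) \<Rightarrow> 'd lseq \<Rightarrow> real measure" where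
  "spectral_meas P u = measure_of UNIV (sets borel) (\<lambda>B. ennreal (Re (ip u (P B u))))"

text \<open>\<open>P\<close> is the spectral resolution of \<open>T\<close>, i.e. \<open>T = \<integral> x dP(x)\<close>. By the spectral
  theorem, a bounded self-adjoint \<open>T\<close> has exactly one (as far as its values on Borel sets and
  on \<open>ell2\<close> are concerned), and \<open>P B\<close> is then the spectral projection \<open>1\<^sub>B(T)\<close>.\<close>

definition spectral_resolution ::
    "('d::finite lseq \<Rightarrow> 'd lseq) \<Rightarrow> (real set \<Rightarrow> 'd lseq \<Rightarrow> 'd lseq) \<Rightarrow> bool" where
  "spectral_resolution T P \<longleftrightarrow> bounded_pvm P \<and>
     (\<forall>u\<in>ell2. integrable (spectral_meas P u) (\<lambda>x. x) \<and>
        of_real (integral\<^sup>L (spectral_meas P u) (\<lambda>x. x)) = ip u (T u))"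

subsection \<open>Unbounded operators, represented by their graphs\<close>

definition graph_closure :: "('d::finite lseq \<times> 'd lseq) set \<Rightarrow> ('d lseq \<times> 'd lseq) set" where
  "graph_closure G =
     {(u, v). u \<in> ell2 \<and> v \<in> ell2 \<and>
        (\<exists>us vs. (\<forall>k::nat. (us k, vs k) \<in> G) \<and>
           (\<lambda>k. l2norm (\<lambda>n. us k n - u n)) \<longlonglongrightarrow> 0 \<and>
           (\<lambda>k. l2norm (\<lambda>n. vs k n - v n)) \<longlonglongrightarrow> 0)}"

definition graph_adjoint :: "('d::finite lseq \<times> 'd lseq) set \<Rightarrow> ('d lseq \<times> 'd lseq) set" where
  "graph_adjoint G =
     {(v, w). v \<in> ell2 \<and> w \<in> ell2 \<and> (\<forall>(u, z)\<in>G. ip z v = ip u w)}"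

definition self_adjoint_graph :: "('d::finite lseq \<times> 'd lseq) set \<Rightarrow> bool" where
  "self_adjoint_graph G \<longleftrightarrow> graph_adjoint G = G"

section \<open>The Molchanov--Vainberg Laplacian and the conjugate operators\<close>

text \<open>\<open>shift i k\<close> is the \<open>k\<close>-th power of \<open>S\<^sub>i\<close>, for any integer \<open>k\<close>.\<close>

definition shift :: "'d::finite \<Rightarrow> int \<Rightarrow> 'd lseq \<Rightarrow> 'd lseq" where
  "shift i k u = (\<lambda>n. u (n - axis i k))"

definition Delta :: "'d::finite \<Rightarrow> 'd lseq \<Rightarrow> 'd lseq" where
  "Delta i u = (\<lambda>n. (shift i 1 u n + shift i (-1) u n) / 2)"

text \<open>The product of the (commuting) \<open>Delta i\<close> over all coordinates \<open>i\<close>.\<close>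

definition MV :: "'d::finite lseq \<Rightarrow> 'd lseq" where
  "MV u = Finite_Set.fold Delta u UNIV"

lemma comp_fun_commute_Delta: "comp_fun_commute (Delta :: 'd::finite \<Rightarrow> _)"
  by unfold_locales
    (auto simp: Delta_def shift_def fun_eq_iff algebra_simps add_divide_distrib)

lemma MV_2: "MV (u :: 2 lseq) = Delta 1 (Delta 2 u)"
proof -
  interpret comp_fun_commute "Delta :: 2 \<Rightarrow> _" by (rule comp_fun_commute_Delta)
  show ?thesis by (simp add: MV_def UNIV_2)
qed

definition pos :: "'d::finite \<Rightarrow> 'd lseq \<Rightarrow> 'd lseq" where
  "pos i u = (\<lambda>n. of_int (n $ i) * u n)"

text \<open>The formal expressions of \<open>A\<^sub>i(p,\<kappa>)\<close> and \<open>A\<^sub>p\<^sub>\<kappa>\<close>, without a choice of domain.\<close>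

definition A_coord :: "nat \<Rightarrow> nat \<Rightarrow> 'd::finite \<Rightarrow> 'd lseq \<Rightarrow> 'd lseq" where
  "A_coord p \<kappa> i u = (\<lambda>n.
     1 / (4 * \<i>) *
       ((shift i (int (p * \<kappa>)) (pos i u) n - shift i (- int (p * \<kappa>)) (pos i u) n) +
        pos i (\<lambda>m. shift i (int (p * \<kappa>)) u m - shift i (- int (p * \<kappa>)) u m) n))"

definition A_op :: "nat \<Rightarrow> nat \<Rightarrow> 'd::finite lseq \<Rightarrow> 'd lseq" where
  "A_op p \<kappa> u = (\<lambda>n. \<Sum>i\<in>UNIV. A_coord p \<kappa> i u n)"

text \<open>The graph of \<open>\<Sum>\<^sub>p \<rho>\<^sub>p A\<^sub>p\<^sub>\<kappa>\<close> on those compactly supported sequences for which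
  the series converges in norm; \<open>\<rho> p\<close> is the coefficient of \<open>A\<^sub>p\<^sub>\<kappa>\<close> and \<open>\<rho> 0\<close> is
  irrelevant. The linear combination is finite iff \<open>\<rho>\<close> vanishes eventually.\<close>

definition comb_graph :: "nat \<Rightarrow> (nat \<Rightarrow> real) \<Rightarrow> ('d::finite lseq \<times> 'd lseq) set" where
  "comb_graph \<kappa> \<rho> =
     {(u, v). u \<in> ell_c \<and> v \<in> ell2 \<and>
        (\<lambda>N. l2norm (\<lambda>n. v n - (\<Sum>p=1..N. of_real (\<rho> p) * A_op p \<kappa> u n))) \<longlonglongrightarrow> 0}"

definition sa_combination :: "nat \<Rightarrow> (nat \<Rightarrow> real) \<Rightarrow> 'd::finite itself \<Rightarrow> bool" where
  "sa_combination \<kappa> \<rho> _ \<longleftrightarrow>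
     (\<forall>u\<in>ell_c. \<exists>v. (u :: 'd lseq, v) \<in> comb_graph \<kappa> \<rho>) \<and>
     self_adjoint_graph (graph_closure (comb_graph \<kappa> \<rho> :: ('d lseq \<times> 'd lseq) set))"

text \<open>\<open>C\<close> is the bounded extension of the commutator of \<open>T\<close> with \<open>\<i>\<close> times the operator with
  graph \<open>G\<close>, taken on compactly supported sequences (\<open>T\<close> has to preserve these).\<close>

definition commutator_ext ::
    "('d::finite lseq \<Rightarrow> 'd lseq) \<Rightarrow> ('d lseq \<times> 'd lseq) set \<Rightarrow> ('d lseq \<Rightarrow> 'd lseq) \<Rightarrow> bool" where
  "commutator_ext T G C \<longleftrightarrow> bounded_op C \<and>
     (\<forall>u\<in>ell_c. \<forall>v w. (u, v) \<in> G \<longrightarrow> (T u, w) \<in> G \<longrightarrow>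
        C u = (\<lambda>n. T (\<lambda>m. \<i> * v m) n - \<i> * w n))"

section \<open>Thresholds\<close>

text \<open>The interval around \<open>E\<close> is open: the spectral projection on the degenerate interval
  \<open>{E}\<close> vanishes and would make the estimate trivial.\<close>

definition mourre_points :: "nat \<Rightarrow> ('d::finite lseq \<Rightarrow> 'd lseq) \<Rightarrow> real set" where
  "mourre_points \<kappa> T =
     {E \<in> real_spectrum T.
        \<exists>\<rho> a b \<gamma> P C.
          sa_combination \<kappa> \<rho> TYPE('d) \<and> a < E \<and> E < b \<and> \<gamma> > 0 \<and>
          spectral_resolution T P \<and>
          commutator_ext T (graph_closure (comb_graph \<kappa> \<rho>)) C \<and>
          (\<forall>u\<in>ell2. Re (ip u (P {a<..<b} (C (P {a<..<b} u))))
                      \<ge> \<gamma> * Re (ip u (P {a<..<b} u)))}"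

definition Theta :: "nat \<Rightarrow> ('d::finite lseq \<Rightarrow> 'd lseq) \<Rightarrow> real set" where
  "Theta \<kappa> T = real_spectrum T - mourre_points \<kappa> T"

fun cheb_T :: "nat \<Rightarrow> real \<Rightarrow> real" where
  "cheb_T 0 x = 1"
| "cheb_T (Suc 0) x = x"
| "cheb_T (Suc (Suc n)) x = 2 * x * cheb_T (Suc n) x - cheb_T n x"

fun cheb_U :: "nat \<Rightarrow> real \<Rightarrow> real" where
  "cheb_U 0 x = 1"
| "cheb_U (Suc 0) x = 2 * x"
| "cheb_U (Suc (Suc n)) x = 2 * x * cheb_U (Suc n) x - cheb_U n x"

lemma cheb_T_cos: "cheb_T n (cos t) = cos (real n * t)"
proof (induction n "cos t" rule: cheb_T.induct)
  case (3 n)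
  have "cos (real (Suc (Suc n)) * t) = cos (real (Suc n) * t + t)"
    "cos (real n * t) = cos (real (Suc n) * t - t)"
    by (simp_all add: algebra_simps)
  then show ?case using 3 by (simp add: cos_add cos_diff)
qed simp_all

lemma cheb_U_cos: "cheb_U n (cos t) * sin t = sin (real (Suc n) * t)"
proof (induction n "cos t" rule: cheb_U.induct)
  case (3 n)
  have "sin (real (Suc (Suc (Suc n))) * t) = sin (real (Suc (Suc n)) * t + t)"
    "sin (real (Suc n) * t) = sin (real (Suc (Suc n)) * t - t)"
    by (simp_all add: algebra_simps)
  moreover have "cheb_U (Suc (Suc n)) (cos t) * sin t =
      2 * cos t * (cheb_U (Suc n) (cos t) * sin t) - cheb_U n (cos t) * sin t"
    by (simp add: algebra_simps)
  ultimately show ?case using 3 by (simp only: sin_add sin_diff) simp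
next
  case 2
  show ?case by (simp add: sin_double)
qed simp_all

definition g_fun :: "nat \<Rightarrow> real ^ 'd::finite \<Rightarrow> real" where
  "g_fun k x = (\<Sum>i\<in>UNIV. (\<Prod>l\<in>UNIV - {i}. x $ l) * (1 - (x $ i)\<^sup>2) * cheb_U (k - 1) (x $ i))"

definition S_set :: "real \<Rightarrow> (real ^ 'd::finite) set" where
  "S_set E = {x. (\<forall>i. -1 \<le> x $ i \<and> x $ i \<le> 1) \<and> (\<Prod>l\<in>UNIV. x $ l) = E}"

text \<open>The set \<open>\<Theta>\<^sub>m\<^sub>,\<^sub>\<kappa>(D)\<close> in dimension \<open>CARD('d)\<close>.\<close>

definition Theta_m :: "'d::finite itself \<Rightarrow> nat \<Rightarrow> nat \<Rightarrow> real set" where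
  "Theta_m _ m \<kappa> =
     {E \<in> {-1..1}. \<exists>(x :: nat \<Rightarrow> real ^ 'd) (\<omega> :: nat \<Rightarrow> real).
        (\<forall>q\<le>m. x q \<in> S_set E) \<and> (\<forall>q<m. \<omega> q \<le> 0) \<and>
        (\<forall>p\<ge>1. g_fun (p * \<kappa>) (x m) = (\<Sum>q<m. \<omega> q * g_fun (p * \<kappa>) (x q)))}"

section \<open>The system\<close>

definition Sigma_system :: "nat \<Rightarrow> nat \<Rightarrow> real \<Rightarrow> (nat \<Rightarrow> real) \<Rightarrow> bool" where
  "Sigma_system \<kappa> n F X \<longleftrightarrow>
     (let b = (if odd n then (int n - 1) div 2 else int n div 2 - 1) in
       (\<forall>q::int. 0 \<le> q \<and> q \<le> b \<longrightarrow> cheb_T \<kappa> (X (nat q)) = cheb_T \<kappa> (X (nat (int n - q)))) \<and>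
       (\<forall>q::int. -1 \<le> q \<and> q \<le> b \<longrightarrow> X (nat (int n - q)) = F / X (nat (1 + q))))"

end

theory Submission
  imports Defs
begin

text \<open>
  A linear relation \<open>g(x\<^sub>m) = \<Sum>\<^sub>q \<omega>\<^sub>q g(x\<^sub>q)\<close> with \<open>\<omega>\<^sub>q \<le> 0\<close> between points of \<open>S_set E\<close> obstructs the
  strict estimate at \<open>E\<close>: the estimate says that \<open>G = \<Sum>\<^sub>p \<rho>\<^sub>p g\<^sub>p\<^sub>\<kappa>\<close> is positive on
  \<open>S_set E\<close>, whereas the relation gives \<open>G(x\<^sub>m) \<le> 0\<close>. For an infinite combination \<open>G\<close> is only
  the symbol of a bounded translation-invariant operator, defined up to null sets, and has no
  values at the points \<open>x\<^sub>q\<close>. The argument therefore goes through Fejer means. A plane wave cut off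
  to the box \<open>[0,R)\<^sup>2\<close> is an approximate eigenvector of the Laplacian, so its spectral projection
  to an interval around the energy is almost the wave itself (\<open>spectral_localization\<close>,
  \<open>packet_residual\<close>). The expectation of the commutator in it is, up to an error
  \<open>O(log R / R)\<close>, the Fejer mean of \<open>G\<close> at the frequency of the wave (\<open>commutator_mean\<close>); the
  error is this small because norm convergence of the combination on the delta sequence forces
  \<open>\<rho>\<^sub>p = O(1/p)\<close> (\<open>comb_coeff_bound\<close>). A Fejer mean is a finite combination of the \<open>g\<^sub>p\<^sub>\<kappa>\<close>, to
  which the linear relation applies. So the estimate makes all Fejer means of large order positive
  at each point of \<open>S_set E\<close> (\<open>mourre_mean_positive\<close>), and the relation excludes this
  (\<open>Theta_m_subset_Theta\<close>).

  The energies come from a one-dimensional dynamical system. Let \<open>a > b > c\<close> be the cosines of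
  \<open>(j-1)\<pi>/\<kappa>\<close>, \<open>j\<pi>/\<kappa>\<close>, \<open>(j+1)\<pi>/\<kappa>\<close>. The reflection
  \<open>\<sigma>(cos t) = cos (2j\<pi>/\<kappa> - t)\<close> interchanges \<open>[b,a]\<close> and \<open>[c,b]\<close>, preserves \<open>T\<^sub>\<kappa>\<close> and changes the
  sign of \<open>sin (p\<kappa>t)\<close> for every \<open>p\<close>. The system links the unknowns alternately by \<open>\<sigma>\<close> and by
  \<open>x \<mapsto> F/x\<close>, so its first half is the orbit of \<open>X\<^sub>0 = F/c\<close> under \<open>x \<mapsto> F/\<sigma>(x)\<close>, and the second half
  is \<open>F\<close> divided by the first. The two halves fit together if the orbit hits \<open>b\<close> at time \<open>m\<close>
  (then \<open>n = 2m\<close>) or \<open>\<surd>F\<close> at time \<open>m\<close> (then \<open>n = 2m - 1\<close>). Orbits increase with \<open>F\<close>, decrease in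
  time as long as \<open>F < ac\<close>, and stay at \<open>a\<close> for \<open>F = ac\<close>; the intermediate value theorem then
  produces both kinds of energies, interlaced (\<open>stage_step\<close>).

  Along such a chain the points \<open>(X\<^sub>n\<^sub>+\<^sub>1\<^sub>-\<^sub>r, X\<^sub>r)\<close> lie on \<open>S_set F\<close>, and the values of \<open>g\<^sub>p\<^sub>\<kappa>\<close> there are
  \<open>\<beta>\<^sub>r s\<^sub>r - \<alpha>\<^sub>r s\<^sub>r\<^sub>-\<^sub>1\<close> with positive \<open>\<alpha>\<^sub>r\<close>, \<open>\<beta>\<^sub>r\<close> not depending on \<open>p\<close>, where
  \<open>s\<^sub>r = sin (p\<kappa> arccos X\<^sub>r)\<close>. Solving for \<open>s\<^sub>r\<close> gives nonnegative combinations of the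
  values of \<open>g\<^sub>p\<^sub>\<kappa>\<close>. At the last point, where the chain closes up, the value of \<open>g\<^sub>p\<^sub>\<kappa>\<close> is a negative
  multiple of the preceding \<open>s\<^sub>r\<close>, which is the required relation (\<open>Theta_m_of_chain\<close>).
\<close>

section \<open>Square-summable sequences\<close>

lemma ell2_abs_summable_prod:
  assumes "u \<in> ell2" "v \<in> ell2"
  shows "(\<lambda>n. norm (cnj (u n) * v n)) summable_on UNIV"
proof (rule summable_on_comparison_test)
  show "(\<lambda>n. (cmod (u n))\<^sup>2 + (cmod (v n))\<^sup>2) summable_on UNIV"
    using assms by (intro summable_on_add) (auto simp: ell2_def)
next
  fix n
  have "0 \<le> (cmod (u n) - cmod (v n))\<^sup>2" by simp
  then have "2 * (cmod (u n) * cmod (v n)) \<le> (cmod (u n))\<^sup>2 + (cmod (v n))\<^sup>2"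
    by (simp add: power2_diff)
  moreover have "0 \<le> cmod (u n) * cmod (v n)" by simp
  ultimately show "norm (cnj (u n) * v n) \<le> (cmod (u n))\<^sup>2 + (cmod (v n))\<^sup>2"
    unfolding norm_mult complex_mod_cnj by linarith
qed simp_all

lemma ell2_summable_prod:
  assumes "u \<in> ell2" "v \<in> ell2"
  shows "(\<lambda>n. cnj (u n) * v n) summable_on UNIV"
  using abs_summable_summable[OF ell2_abs_summable_prod[OF assms]] .

lemma ell2_lin:
  assumes "u \<in> ell2" "v \<in> ell2"
  shows "(\<lambda>n. u n + c * v n) \<in> ell2"
proof -
  have "(\<lambda>n. (cmod (u n + c * v n))\<^sup>2) summable_on UNIV"
  proof (rule summable_on_comparison_test)
    show "(\<lambda>n. 2 * (cmod (u n))\<^sup>2 + 2 * (cmod c)\<^sup>2 * (cmod (v n))\<^sup>2) summable_on UNIV"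
      using assms by (intro summable_on_add summable_on_cmult_right) (auto simp: ell2_def)
  next
    fix n
    have "(cmod (u n + c * v n))\<^sup>2 \<le> (cmod (u n) + cmod (c * v n))\<^sup>2"
      by (intro power_mono norm_triangle_ineq) simp
    also have "\<dots> \<le> 2 * (cmod (u n))\<^sup>2 + 2 * (cmod (c * v n))\<^sup>2"
      using zero_le_power2[of "cmod (u n) - cmod (c * v n)"]
      by (simp add: power2_diff power2_sum)
    finally show "(cmod (u n + c * v n))\<^sup>2 \<le> 2 * (cmod (u n))\<^sup>2 + 2 * (cmod c)\<^sup>2 * (cmod (v n))\<^sup>2"
      by (simp add: norm_mult power_mult_distrib)
  qed simp_all
  then show ?thesis by (simp add: ell2_def)
qed

lemma ell2_zero: "(\<lambda>n. 0) \<in> ell2"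
  by (simp add: ell2_def)

lemma ell2_cmult: "u \<in> ell2 \<Longrightarrow> (\<lambda>n. c * u n) \<in> ell2"
  using ell2_lin[OF ell2_zero] by force

lemma ell2_add: "u \<in> ell2 \<Longrightarrow> v \<in> ell2 \<Longrightarrow> (\<lambda>n. u n + v n) \<in> ell2"
  using ell2_lin[where c = 1] by force

lemma ell2_diff: "u \<in> ell2 \<Longrightarrow> v \<in> ell2 \<Longrightarrow> (\<lambda>n. u n - v n) \<in> ell2"
  using ell2_lin[where c = "-1"] by force

lemma ip_lin_right:
  assumes "u \<in> ell2" "v \<in> ell2" "w \<in> ell2"
  shows "ip u (\<lambda>n. v n + c * w n) = ip u v + c * ip u w"
proof -
  have "ip u (\<lambda>n. v n + c * w n) = (\<Sum>\<^sub>\<infinity>n. cnj (u n) * v n + c * (cnj (u n) * w n))"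
    unfolding ip_def by (simp add: algebra_simps)
  also have "\<dots> = ip u v + c * ip u w"
    unfolding ip_def using assms
    by (simp add: infsum_add infsum_cmult_right ell2_summable_prod summable_on_cmult_right)
  finally show ?thesis .
qed

lemma ip_cnj: "ip v u = cnj (ip u v)"
  unfolding ip_def infsum_cnj[symmetric] by (simp add: mult.commute)

lemma ip_lin_left:
  assumes "u \<in> ell2" "v \<in> ell2" "w \<in> ell2"
  shows "ip (\<lambda>n. v n + c * w n) u = ip v u + cnj c * ip w u"
  using ip_lin_right[OF assms, of c] ip_cnj[of "\<lambda>n. v n + c * w n" u] ip_cnj[of v u] ip_cnj[of w u]
  by simp

lemma ip_lin_self:
  assumes "u \<in> ell2" "v \<in> ell2"
  shows "ip (\<lambda>n. u n + c * v n) (\<lambda>n. u n + c * v n)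
    = ip u u + cnj c * ip v u + c * (ip u v + cnj c * ip v v)"
  using assms ell2_lin[OF assms, of c] by (simp add: ip_lin_right ip_lin_left)

lemma ip_diff_right:
  "u \<in> ell2 \<Longrightarrow> v \<in> ell2 \<Longrightarrow> w \<in> ell2 \<Longrightarrow> ip u (\<lambda>n. v n - w n) = ip u v - ip u w"
  using ip_lin_right[of u v w "-1"] by simp

lemma ip_diff_left:
  "u \<in> ell2 \<Longrightarrow> v \<in> ell2 \<Longrightarrow> w \<in> ell2 \<Longrightarrow> ip (\<lambda>n. v n - w n) u = ip v u - ip w u"
  using ip_lin_left[of u v w "-1"] by simp

lemma ip_add_right:
  "u \<in> ell2 \<Longrightarrow> v \<in> ell2 \<Longrightarrow> w \<in> ell2 \<Longrightarrow> ip u (\<lambda>n. v n + w n) = ip u v + ip u w"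
  using ip_lin_right[of u v w "1"] by simp

lemma ip_add_left:
  "u \<in> ell2 \<Longrightarrow> v \<in> ell2 \<Longrightarrow> w \<in> ell2 \<Longrightarrow> ip (\<lambda>n. v n + w n) u = ip v u + ip w u"
  using ip_lin_left[of u v w "1"] by simp

lemma l2norm_nonneg: "0 \<le> l2norm u"
  unfolding l2norm_def by (simp add: infsum_nonneg)

lemma l2norm_sq: "(l2norm u)\<^sup>2 = (\<Sum>\<^sub>\<infinity>n. (cmod (u n))\<^sup>2)"
  unfolding l2norm_def by (simp add: infsum_nonneg)

lemma ip_self: "ip u u = of_real ((l2norm u)\<^sup>2)"
proof -
  have "ip u u = (\<Sum>\<^sub>\<infinity>n. complex_of_real ((cmod (u n))\<^sup>2))"
    unfolding ip_def by (simp add: complex_norm_square[symmetric] mult.commute)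
  also have "\<dots> = of_real (\<Sum>\<^sub>\<infinity>n. (cmod (u n))\<^sup>2)"
    using summable_on_bounded_linear_iff[OF bounded_linear_of_real bounded_linear_Re Re_complex_of_real]
    by (rule infsum_bounded_linear_strong) (rule bounded_linear_of_real)
  finally show ?thesis by (simp only: l2norm_sq)
qed

lemma cmod_le_l2norm:
  assumes "u \<in> ell2"
  shows "cmod (u n) \<le> l2norm u"
proof -
  have "(\<Sum>\<^sub>\<infinity>n\<in>{n}. (cmod (u n))\<^sup>2) \<le> (\<Sum>\<^sub>\<infinity>n. (cmod (u n))\<^sup>2)"
    using assms by (intro infsum_mono_neutral) (auto simp: ell2_def)
  then have "(cmod (u n))\<^sup>2 \<le> (l2norm u)\<^sup>2" by (simp add: l2norm_sq)
  then show ?thesis using l2norm_nonneg by (rule power2_le_imp_le)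
qed

lemma cauchy_schwarz:
  assumes "u \<in> ell2" "v \<in> ell2"
  shows "cmod (ip u v) \<le> l2norm u * l2norm v"
proof (cases "l2norm v = 0")
  case True
  then have "v = (\<lambda>n. 0)" using cmod_le_l2norm[OF assms(2)] by (auto simp: fun_eq_iff)
  then show ?thesis by (simp add: ip_def l2norm_nonneg)
next
  case False
  then have pos: "0 < (l2norm v)\<^sup>2" by simp
  \<comment> \<open>\<open>u + c v\<close> is the component of \<open>u\<close> orthogonal to \<open>v\<close>.\<close>
  define c where "c = - cnj (ip u v) / of_real ((l2norm v)\<^sup>2)"
  define z where "z = (\<lambda>n. u n + c * v n)"
  have z: "z \<in> ell2" unfolding z_def by (intro ell2_lin assms)
  have "ip z z = ip u u + cnj c * cnj (ip u v) + c * (ip u v + cnj c * ip v v)"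
    unfolding z_def ip_lin_self[OF assms] ip_cnj[of v u] ..
  also have "cnj c * ip v v = - ip u v"
    using False by (simp add: c_def ip_self)
  finally have "ip z z = ip u u + cnj c * cnj (ip u v)" by simp
  also have "cnj c * cnj (ip u v) = - of_real ((cmod (ip u v))\<^sup>2 / (l2norm v)\<^sup>2)"
    unfolding c_def by (simp add: complex_norm_square[symmetric])
  finally have "complex_of_real ((l2norm z)\<^sup>2)
      = of_real ((l2norm u)\<^sup>2 - (cmod (ip u v))\<^sup>2 / (l2norm v)\<^sup>2)"
    by (simp add: ip_self)
  then have "(l2norm z)\<^sup>2 = (l2norm u)\<^sup>2 - (cmod (ip u v))\<^sup>2 / (l2norm v)\<^sup>2"
    by (simp only: of_real_eq_iff)
  then have "(cmod (ip u v))\<^sup>2 / (l2norm v)\<^sup>2 \<le> (l2norm u)\<^sup>2"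
    using zero_le_power2[of "l2norm z"] by linarith
  then have "(cmod (ip u v))\<^sup>2 \<le> (l2norm u * l2norm v)\<^sup>2"
    using pos by (simp add: divide_le_eq power_mult_distrib)
  then show ?thesis by (rule power2_le_imp_le) (simp add: l2norm_nonneg)
qed

lemma l2norm_eq_0: "u \<in> ell2 \<Longrightarrow> l2norm u = 0 \<Longrightarrow> u = (\<lambda>n. 0)"
  using cmod_le_l2norm[of u] by (auto simp: fun_eq_iff)

lemma l2norm_triangle:
  assumes "u \<in> ell2" "v \<in> ell2"
  shows "l2norm (\<lambda>n. u n + v n) \<le> l2norm u + l2norm v"
proof -
  have "complex_of_real ((l2norm (\<lambda>n. u n + v n))\<^sup>2)
      = ip u u + ip u v + (cnj (ip u v) + ip v v)"
    unfolding ip_self[symmetric]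
    using ip_lin_self[OF assms, of 1] by (simp add: ip_cnj[of v u])
  then have "(l2norm (\<lambda>n. u n + v n))\<^sup>2 = Re (ip u u + ip u v + (cnj (ip u v) + ip v v))"
    by (metis Re_complex_of_real)
  also have "\<dots> = (l2norm u)\<^sup>2 + 2 * Re (ip u v) + (l2norm v)\<^sup>2"
    by (simp add: ip_self)
  also have "\<dots> \<le> (l2norm u)\<^sup>2 + 2 * (l2norm u * l2norm v) + (l2norm v)\<^sup>2"
    using complex_Re_le_cmod[of "ip u v"] cauchy_schwarz[OF assms] by linarith
  also have "\<dots> = (l2norm u + l2norm v)\<^sup>2" by (simp add: power2_sum)
  finally show ?thesis by (rule power2_le_imp_le) (simp add: l2norm_nonneg)
qed

lemma ell_c_subset_ell2: "u \<in> ell_c \<Longrightarrow> u \<in> ell2"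
proof -
  assume "u \<in> ell_c"
  then have "finite {n. u n \<noteq> 0}" by (simp add: ell_c_def)
  then have "(\<lambda>n. (cmod (u n))\<^sup>2) summable_on {n. u n \<noteq> 0}" by (rule summable_on_finite)
  then show ?thesis
    unfolding ell2_def mem_Collect_eq
    by (subst summable_on_cong_neutral[where T = "{n. u n \<noteq> 0}" and g = "\<lambda>n. (cmod (u n))\<^sup>2"]) auto
qed

lemma ip_finite:
  assumes "finite S" "\<And>n. n \<notin> S \<Longrightarrow> u n = 0"
  shows "ip u v = (\<Sum>n\<in>S. cnj (u n) * v n)"
proof -
  have "ip u v = (\<Sum>\<^sub>\<infinity>n\<in>S. cnj (u n) * v n)"
    unfolding ip_def using assms(2) by (intro infsum_cong_neutral) auto
  then show ?thesis using assms(1) by simp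
qed

section \<open>Projection-valued measures and spectral localization\<close>

lemma orth_projection_ip:
  assumes "orth_projection Q" "u \<in> ell2"
  shows "ip u (Q u) = of_real ((l2norm (Q u))\<^sup>2)"
proof -
  have Q: "Q u \<in> ell2" "Q (Q u) = Q u" using assms by (auto simp: orth_projection_def bounded_op_def)
  have "ip (Q u) (Q u) = ip u (Q (Q u))"
    using assms Q(1) by (auto simp: orth_projection_def)
  then show ?thesis using Q(2) by (simp add: ip_self)
qed

lemma orth_projection_norm_le:
  assumes "orth_projection Q" "u \<in> ell2"
  shows "l2norm (Q u) \<le> l2norm u"
proof -
  have Q: "Q u \<in> ell2" using assms by (auto simp: orth_projection_def bounded_op_def)
  have "(l2norm (Q u))\<^sup>2 \<le> l2norm u * l2norm (Q u)"
    using cauchy_schwarz[OF assms(2) Q]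
    unfolding orth_projection_ip[OF assms] by (simp only: norm_of_real abs_power2)
  then have "l2norm (Q u) * l2norm (Q u) \<le> l2norm u * l2norm (Q u)" by (simp add: power2_eq_square)
  then show ?thesis
    using l2norm_nonneg[of "Q u"] l2norm_nonneg[of u] by (cases "l2norm (Q u) = 0") auto
qed

lemma bounded_op_diff:
  assumes "bounded_op Q" "u \<in> ell2" "v \<in> ell2"
  shows "Q (\<lambda>n. u n - v n) = (\<lambda>n. Q u n - Q v n)"
proof -
  have "Q (\<lambda>n. u n + (-1) * v n) = (\<lambda>n. Q u n + (-1) * Q v n)"
    using assms unfolding bounded_op_def by blast
  then show ?thesis by simp
qed

lemma bounded_op_ell2: "bounded_op Q \<Longrightarrow> u \<in> ell2 \<Longrightarrow> Q u \<in> ell2"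
  by (simp add: bounded_op_def)

lemma pvm_proj: "bounded_pvm P \<Longrightarrow> B \<in> sets borel \<Longrightarrow> orth_projection (P B)"
  by (simp add: bounded_pvm_def)

lemma pvm_bounded_op: "bounded_pvm P \<Longrightarrow> B \<in> sets borel \<Longrightarrow> bounded_op (P B)"
  by (simp add: bounded_pvm_def orth_projection_def)

lemma pvm_ell2: "bounded_pvm P \<Longrightarrow> B \<in> sets borel \<Longrightarrow> u \<in> ell2 \<Longrightarrow> P B u \<in> ell2"
  by (rule bounded_op_ell2[OF pvm_bounded_op])

lemma pvm_Int:
  "bounded_pvm P \<Longrightarrow> A \<in> sets borel \<Longrightarrow> B \<in> sets borel \<Longrightarrow> u \<in> ell2 \<Longrightarrow> P A (P B u) = P (A \<inter> B) u"
  by (simp add: bounded_pvm_def)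

lemma pvm_empty: "bounded_pvm P \<Longrightarrow> u \<in> ell2 \<Longrightarrow> P {} u = (\<lambda>n. 0)"
  by (simp add: bounded_pvm_def)

lemma pvm_sym:
  "bounded_pvm P \<Longrightarrow> B \<in> sets borel \<Longrightarrow> u \<in> ell2 \<Longrightarrow> v \<in> ell2 \<Longrightarrow> ip (P B u) v = ip u (P B v)"
  by (simp add: bounded_pvm_def orth_projection_def)

lemma pvm_UNIV:
  assumes "bounded_pvm P" "u \<in> ell2"
  shows "P UNIV u = u"
proof -
  obtain R where R: "\<forall>u\<in>ell2. P {-R<..<R} u = u" using assms(1) by (auto simp: bounded_pvm_def)
  have "P UNIV (P {-R<..<R} u) = P (UNIV \<inter> {-R<..<R}) u"
    using assms by (intro pvm_Int) auto
  then show ?thesis using R assms(2) by simp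
qed

lemma ip_sum_right:
  assumes "u \<in> ell2" "\<And>i. i \<in> I \<Longrightarrow> v i \<in> ell2" "finite I"
  shows "(\<lambda>n. \<Sum>i\<in>I. v i n) \<in> ell2 \<and> ip u (\<lambda>n. \<Sum>i\<in>I. v i n) = (\<Sum>i\<in>I. ip u (v i))"
  using assms(3,2)
proof (induction I rule: finite_induct)
  case empty
  show ?case by (simp add: ell2_zero ip_def)
next
  case (insert i I)
  then show ?case using assms(1) by (simp add: ell2_add ip_add_right)
qed

text \<open>Countable additivity holds in norm, hence after pairing with \<open>u\<close>; this is what
  turns \<open>B \<mapsto> \<langle>u, P B u\<rangle>\<close> into a measure.\<close>

lemma pvm_ip_sums:
  assumes P: "bounded_pvm P" and u: "u \<in> ell2"
    and B: "range B \<subseteq> sets borel" "disjoint_family (B :: nat \<Rightarrow> real set)"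
  shows "(\<lambda>i. Re (ip u (P (B i) u))) sums Re (ip u (P (\<Union>i. B i) u))"
proof -
  have Bi: "B i \<in> sets borel" for i using B(1) by auto
  have UB: "(\<Union>i. B i) \<in> sets borel" using B(1) by auto
  let ?d = "\<lambda>N n. P (\<Union>i. B i) u n - (\<Sum>i<N. P (B i) u n)"
  have lim: "(\<lambda>N. l2norm (?d N)) \<longlonglongrightarrow> 0"
    using P u B unfolding bounded_pvm_def by blast
  have d: "?d N \<in> ell2 \<and> ip u (?d N) = ip u (P (\<Union>i. B i) u) - (\<Sum>i<N. ip u (P (B i) u))" for N
    using ip_sum_right[of u "{..<N}" "\<lambda>i. P (B i) u"] u pvm_ell2[OF P Bi u] pvm_ell2[OF P UB u]
    by (simp add: ell2_diff ip_diff_right)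
  have "(\<lambda>N. ip u (P (\<Union>i. B i) u) - (\<Sum>i<N. ip u (P (B i) u))) \<longlonglongrightarrow> 0"
  proof (rule Lim_null_comparison)
    show "\<forall>\<^sub>F N in sequentially. norm (ip u (P (\<Union>i. B i) u) - (\<Sum>i<N. ip u (P (B i) u)))
        \<le> l2norm u * l2norm (?d N)"
      using cauchy_schwarz[OF u] d by (intro always_eventually allI) (metis (no_types, lifting))
    show "(\<lambda>N. l2norm u * l2norm (?d N)) \<longlonglongrightarrow> 0"
      using tendsto_mult_right_zero[OF lim] .
  qed
  from tendsto_Re[OF this] have "(\<lambda>N. Re (ip u (P (\<Union>i. B i) u)) - (\<Sum>i<N. Re (ip u (P (B i) u)))) \<longlonglongrightarrow> 0"
    by simp
  from tendsto_diff[OF tendsto_const[of "Re (ip u (P (\<Union>i. B i) u))"] this]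
  show ?thesis unfolding sums_def by simp
qed

text \<open>Countable additivity for \<open>A, B, \<emptyset>, \<emptyset>, \<dots>\<close>: the norms are constant from the second
  partial sum on, and a constant null sequence is zero.\<close>

lemma pvm_disjoint_Un:
  assumes P: "bounded_pvm P" and u: "u \<in> ell2"
    and AB: "A \<in> sets borel" "B \<in> sets borel" "A \<inter> B = {}"
  shows "P (A \<union> B) u = (\<lambda>n. P A u n + P B u n)"
proof -
  let ?B = "binaryset A B"
  let ?d = "\<lambda>n. P (A \<union> B) u n - (P A u n + P B u n)"
  have U: "(\<Union>i. ?B i) = A \<union> B" by (simp add: UN_binaryset_eq)
  have "(\<lambda>N. l2norm (\<lambda>n. P (\<Union>i. ?B i) u n - (\<Sum>i<N. P (?B i) u n))) \<longlonglongrightarrow> 0"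
  proof -
    have "range ?B \<subseteq> sets borel" using AB by (auto simp: range_binaryset_eq)
    moreover have "disjoint_family ?B"
      using AB(3) by (auto simp: disjoint_family_on_def binaryset_def)
    ultimately show ?thesis using P u unfolding bounded_pvm_def by blast
  qed
  then have "(\<lambda>N. l2norm (\<lambda>n. P (\<Union>i. ?B i) u n - (\<Sum>i<N+2. P (?B i) u n))) \<longlonglongrightarrow> 0"
    by (rule LIMSEQ_ignore_initial_segment)
  moreover have "(\<Sum>i<N+2. P (?B i) u n) = P A u n + P B u n" for N n
  proof -
    have "(\<Sum>i<N+2. P (?B i) u n) = (\<Sum>i<2. P (?B i) u n)"
      by (rule sum.mono_neutral_right) (auto simp: binaryset_def pvm_empty[OF P u])
    then show ?thesis by (simp add: binaryset_def numeral_2_eq_2)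
  qed
  ultimately have "(\<lambda>N::nat. l2norm ?d) \<longlonglongrightarrow> 0" unfolding U by simp
  then have "l2norm ?d = 0" by (simp add: LIMSEQ_const_iff)
  moreover have "?d \<in> ell2"
    using pvm_ell2[OF P _ u] AB by (intro ell2_diff ell2_add) auto
  ultimately have "?d = (\<lambda>n. 0)" by (rule l2norm_eq_0[rotated])
  then show ?thesis by (auto simp: fun_eq_iff)
qed

lemma pvm_ip_nonneg: "bounded_pvm P \<Longrightarrow> u \<in> ell2 \<Longrightarrow> B \<in> sets borel \<Longrightarrow> 0 \<le> Re (ip u (P B u))"
  by (simp add: orth_projection_ip[OF pvm_proj])

lemma emeasure_spectral_meas:
  assumes P: "bounded_pvm P" and u: "u \<in> ell2" and B: "B \<in> sets borel"
  shows "emeasure (spectral_meas P u) B = ennreal (Re (ip u (P B u)))"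
proof (rule emeasure_measure_of[OF spectral_meas_def])
  show "positive (sets (spectral_meas P u)) (\<lambda>B. ennreal (Re (ip u (P B u))))"
    by (simp add: positive_def pvm_empty[OF P u] ip_def)
  show "countably_additive (sets (spectral_meas P u)) (\<lambda>B. ennreal (Re (ip u (P B u))))"
  proof (rule countably_additiveI)
    fix B :: "nat \<Rightarrow> real set"
    assume B: "range B \<subseteq> sets (spectral_meas P u)" "disjoint_family B"
    have "sets (spectral_meas P u) = sets borel"
      unfolding spectral_meas_def by (metis sets.sigma_sets_eq sets_measure_of space_borel subset_Pow_Union top_greatest Pow_UNIV)
    then have B': "range B \<subseteq> sets borel" using B by simp
    then have "B i \<in> sets borel" for i by auto
    then show "(\<Sum>i. ennreal (Re (ip u (P (B i) u)))) = ennreal (Re (ip u (P (\<Union>i. B i) u)))"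
      using pvm_ip_sums[OF P u B' B(2)] pvm_ip_nonneg[OF P u]
      by (intro suminf_ennreal_eq) auto
  qed
qed (use B in \<open>auto simp: spectral_meas_def\<close>)

lemma sets_spectral_meas [measurable_cong]: "sets (spectral_meas P u) = sets borel"
  unfolding spectral_meas_def
  by (metis sets.sigma_sets_eq sets_measure_of space_borel subset_Pow_Union top_greatest Pow_UNIV)

lemma spectral_meas_eqI:
  assumes P: "bounded_pvm P" and w: "w \<in> ell2" and M: "sets M = sets borel"
    and eq: "\<And>A. A \<in> sets borel \<Longrightarrow> emeasure M A = ennreal (Re (ip w (P A w)))"
  shows "spectral_meas P w = M"
  using M eq by (intro measure_eqI) (auto simp: sets_spectral_meas emeasure_spectral_meas[OF P w])

text \<open>Cutting the spectral measure down to \<open>B\<close> gives the spectral measure of the component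
  \<open>P B u\<close>. Expressing the measures of \<open>P B u\<close> and of \<open>u - P B u\<close> as such densities reduces
  integrals over them to integrals over one measure.\<close>

lemma emeasure_density_spectral:
  assumes P: "bounded_pvm P" and u: "u \<in> ell2" and B: "B \<in> sets borel" and A: "A \<in> sets borel"
  shows "emeasure (density (spectral_meas P u) (\<lambda>x. ennreal (indicator B x))) A = ennreal (Re (ip u (P (A \<inter> B) u)))"
proof -
  have "emeasure (density (spectral_meas P u) (\<lambda>x. ennreal (indicator B x))) A
     = (\<integral>\<^sup>+x. indicator (A \<inter> B) x \<partial>spectral_meas P u)"
  proof -
    have "ennreal (indicator B x) * indicator A x = indicator (A \<inter> B) x" for x
      by (auto simp: indicator_def)
    then show ?thesis using A B by (subst emeasure_density) (simp_all add: sets_spectral_meas)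
  qed
  also have "\<dots> = emeasure (spectral_meas P u) (A \<inter> B)"
    using A B by (simp add: sets_spectral_meas)
  finally show ?thesis using A B by (simp add: emeasure_spectral_meas[OF P u])
qed

text \<open>The component \<open>w = P B u\<close> has its spectral measure on \<open>B\<close>, where \<open>s (x - E) \<ge> \<delta>\<close>, so
  \<open>s \<langle>w, (T - E) w\<rangle> \<ge> \<delta> \<parallel>w\<parallel>\<^sup>2\<close>. The remainder \<open>v = u - w\<close> has its spectral measure on the
  complement; the measure of \<open>u\<close> is the sum of the two, which kills the real part of
  \<open>\<langle>w, T v\<rangle>\<close>. Hence \<open>\<delta> \<parallel>w\<parallel>\<^sup>2 \<le> s Re \<langle>w, (T - E) u\<rangle>\<close>, and Cauchy-Schwarz finishes.\<close>

lemma spectral_tail_bound: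
  assumes S: "spectral_resolution T P"
    and T2: "\<And>u. u \<in> ell2 \<Longrightarrow> T u \<in> ell2"
    and Tlin: "\<And>u v. u \<in> ell2 \<Longrightarrow> v \<in> ell2 \<Longrightarrow> T (\<lambda>n. u n + v n) = (\<lambda>n. T u n + T v n)"
    and Tsym: "\<And>u v. u \<in> ell2 \<Longrightarrow> v \<in> ell2 \<Longrightarrow> ip (T u) v = ip u (T v)"
    and u: "u \<in> ell2" and B: "B \<in> sets borel"
    and s: "\<bar>s\<bar> = 1" and \<delta>: "\<And>x. x \<in> B \<Longrightarrow> \<delta> \<le> s * (x - E)"
  shows "\<delta> * l2norm (P B u) \<le> l2norm (\<lambda>n. T u n - of_real E * u n)"
proof -
  have P: "bounded_pvm P" using S by (simp add: spectral_resolution_def)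
  define w where "w = P B u"
  define v where "v = (\<lambda>n. u n - w n)"
  define M where "M = spectral_meas P u"
  have w: "w \<in> ell2" unfolding w_def using P B u by (rule pvm_ell2)
  have v: "v \<in> ell2" unfolding v_def using u w by (rule ell2_diff)
  have Mi: "integrable M (\<lambda>x. x)" and MT: "ip u (T u) = of_real (integral\<^sup>L M (\<lambda>x. x))"
    using S u by (auto simp: spectral_resolution_def M_def)
  have setsM [measurable_cong]: "sets M = sets borel" by (simp add: M_def sets_spectral_meas)
  have spM: "space M = UNIV" using setsM sets_eq_imp_space_eq by fastforce
  have Mfin: "emeasure M A = ennreal (Re (ip u (P A u)))" if "A \<in> sets borel" for A
    using emeasure_spectral_meas[OF P u that] by (simp add: M_def)
  have PA: "ip w (P A w) = ip u (P (A \<inter> B) u)" if A: "A \<in> sets borel" for A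
  proof -
    have "ip w (P A w) = ip u (P B (P A (P B u)))"
      unfolding w_def using pvm_sym[OF P B u] pvm_ell2[OF P A] pvm_ell2[OF P B u] by simp
    also have "\<dots> = ip u (P (A \<inter> B) u)"
      using A B u pvm_ell2[OF P B u] by (simp add: pvm_Int[OF P] Int_ac)
    finally show ?thesis .
  qed
  have PAv: "P A v = (\<lambda>n. P A u n - P (A \<inter> B) u n)" if A: "A \<in> sets borel" for A
    unfolding v_def using bounded_op_diff[OF pvm_bounded_op[OF P A] u w] A B u
    by (simp add: w_def pvm_Int[OF P])
  have PAv': "ip v (P A v) = ip u (P (A \<inter> (-B)) u)" if A: "A \<in> sets borel" for A
  proof -
    have "A = (A \<inter> B) \<union> (A \<inter> (-B))" by auto
    then have "P A u = (\<lambda>n. P (A \<inter> B) u n + P (A \<inter> (-B)) u n)"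
      using pvm_disjoint_Un[OF P u, of "A \<inter> B" "A \<inter> (-B)"] A B by auto
    then have PAv2: "P A v = P (A \<inter> (-B)) u" by (simp add: PAv[OF A] fun_eq_iff)
    have "P B (P (A \<inter> (-B)) u) = (\<lambda>n. 0)"
      using A B u by (subst pvm_Int[OF P]) (auto simp: pvm_empty[OF P])
    then have "ip w (P (A \<inter> (-B)) u) = 0"
      unfolding w_def using A B u by (subst pvm_sym[OF P]) (auto simp: ip_def intro!: pvm_ell2[OF P])
    then show ?thesis unfolding PAv2 unfolding v_def
      using u w A B by (subst ip_diff_left) (auto intro!: pvm_ell2[OF P])
  qed
  have int: "ip z (T z) = of_real (\<integral>x. indicator D x * x \<partial>M)"
    if z: "z \<in> ell2" and D: "D \<in> sets borel"
      and eq: "\<And>A. A \<in> sets borel \<Longrightarrow> ip z (P A z) = ip u (P (A \<inter> D) u)" for z D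
  proof -
    have "spectral_meas P z = density M (\<lambda>x. ennreal (indicator D x))"
      unfolding M_def using emeasure_density_spectral[OF P u D] eq
      by (intro spectral_meas_eqI[OF P z]) (auto simp: sets_spectral_meas)
    moreover have "of_real (integral\<^sup>L (spectral_meas P z) (\<lambda>x. x)) = ip z (T z)"
      using S z by (simp add: spectral_resolution_def)
    ultimately have "of_real (integral\<^sup>L (density M (\<lambda>x. ennreal (indicator D x))) (\<lambda>x. x)) = ip z (T z)"
      by simp
    moreover have "integral\<^sup>L (density M (\<lambda>x. ennreal (indicator D x))) (\<lambda>x. x) = (\<integral>x. indicator D x *\<^sub>R x \<partial>M)"
    proof (rule integral_density)
      show "(\<lambda>x. x) \<in> borel_measurable M"
        using setsM by (intro measurable_ident_sets)
      show "(\<lambda>x. indicator D x) \<in> borel_measurable M"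
        using D setsM by (intro borel_measurable_indicator) simp
    qed simp
    ultimately show ?thesis by simp
  qed
  have iw: "ip w (T w) = of_real (\<integral>x. indicator B x * x \<partial>M)"
    by (rule int[OF w B PA])
  have iv: "ip v (T v) = of_real (\<integral>x. indicator (-B) x * x \<partial>M)"
    using B by (intro int[OF v _ PAv']) auto
  have inB: "integrable M (\<lambda>x. indicator D x * x)" if "D \<in> sets borel" for D :: "real set"
    using integrable_real_mult_indicator[of D M "\<lambda>x. x"] Mi that setsM by (simp add: mult.commute)
  have sum: "ip u (T u) = ip w (T w) + ip v (T v)"
  proof -
    have "(\<integral>x. x \<partial>M) = (\<integral>x. indicator B x * x + indicator (-B) x * x \<partial>M)"
      by (intro Bochner_Integration.integral_cong) (auto simp: indicator_def)
    also have "\<dots> = (\<integral>x. indicator B x * x \<partial>M) + (\<integral>x. indicator (-B) x * x \<partial>M)"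
      using B by (intro Bochner_Integration.integral_add inB) auto
    finally show ?thesis by (simp add: MT iw iv)
  qed
  have uvw: "u = (\<lambda>n. w n + v n)" by (simp add: v_def)
  have Tu: "T u = (\<lambda>n. T w n + T v n)" using Tlin[OF w v] uvw by simp
  have "ip u (T u) = ip w (T w) + ip w (T v) + (ip v (T w) + ip v (T v))"
    unfolding Tu unfolding uvw using w v T2
    by (simp add: ip_add_left ip_add_right ell2_add)
  then have "ip w (T v) + ip v (T w) = 0" using sum by (simp add: algebra_simps)
  moreover have "ip v (T w) = cnj (ip w (T v))"
    using Tsym[OF v w] ip_cnj[of "T v" w] by simp
  ultimately have cross: "Re (ip w (T v)) = 0"
    by (metis Re_complex_of_real complex_add_cnj mult_eq_0_iff of_real_eq_0_iff zero_neq_numeral)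
  have nw: "(l2norm w)\<^sup>2 = measure M B"
  proof -
    have "ip u (P B u) = of_real ((l2norm w)\<^sup>2)"
      unfolding w_def by (rule orth_projection_ip[OF pvm_proj[OF P B] u])
    then show ?thesis using Mfin[OF B] by (simp add: measure_def)
  qed
  have iwu: "ip w u = of_real ((l2norm w)\<^sup>2)"
    using orth_projection_ip[OF pvm_proj[OF P B] u] ip_cnj[of w u] by (simp add: w_def)
  have Bfin: "emeasure M B < \<infinity>" using Mfin[OF B] by simp
  have iB: "integrable M (\<lambda>x. indicator B x :: real)"
    using Bfin B by (intro integrable_real_indicator) (auto simp: setsM)
  have "\<delta> * (l2norm w)\<^sup>2 = (\<integral>x. \<delta> * indicator B x \<partial>M)"
    using B by (simp add: nw setsM spM)
  also have "\<dots> \<le> (\<integral>x. s * (indicator B x * x - E * indicator B x) \<partial>M)"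
    using \<delta> B by (intro integral_mono integrable_mult_right Bochner_Integration.integrable_diff inB iB)
       (auto simp: indicator_def)
  also have "\<dots> = s * ((\<integral>x. indicator B x * x \<partial>M) - E * (l2norm w)\<^sup>2)"
    using inB[OF B] iB B by (simp add: nw setsM spM)
  also have "\<dots> = s * Re (ip w (\<lambda>n. T u n - of_real E * u n))"
  proof -
    have "ip w (\<lambda>n. T u n - of_real E * u n) = ip w (T u) + (- of_real E) * ip w u"
      using ip_lin_right[OF w T2[OF u] u, of "- of_real E"] by simp
    moreover have "ip w (T u) = ip w (T w) + ip w (T v)"
      unfolding Tu using w v T2 by (simp add: ip_add_right)
    ultimately show ?thesis using cross by (simp add: iw iwu)
  qed
  also have "\<dots> \<le> cmod (ip w (\<lambda>n. T u n - of_real E * u n))"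
    using abs_Re_le_cmod[of "ip w (\<lambda>n. T u n - of_real E * u n)"] s
    by (metis abs_le_D1 abs_mult mult_1)
  also have "\<dots> \<le> l2norm w * l2norm (\<lambda>n. T u n - of_real E * u n)"
    using ell2_diff[OF T2[OF u] ell2_cmult[OF u]] by (intro cauchy_schwarz w) auto
  finally have "l2norm w * (\<delta> * l2norm w) \<le> l2norm w * l2norm (\<lambda>n. T u n - of_real E * u n)"
    by (simp add: power2_eq_square algebra_simps)
  then show ?thesis
    using l2norm_nonneg[of w] l2norm_nonneg[of "\<lambda>n. T u n - of_real E * u n"]
    unfolding w_def[symmetric]
    by (cases "l2norm w = 0") auto
qed

text \<open>The sign \<open>s\<close> of \<open>spectral_tail_bound\<close> covers the part of the spectrum below \<open>a\<close> and
  the part above \<open>b\<close>.\<close>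

lemma spectral_localization:
  assumes S: "spectral_resolution T P"
    and T2: "\<And>u. u \<in> ell2 \<Longrightarrow> T u \<in> ell2"
    and Tlin: "\<And>u v. u \<in> ell2 \<Longrightarrow> v \<in> ell2 \<Longrightarrow> T (\<lambda>n. u n + v n) = (\<lambda>n. T u n + T v n)"
    and Tsym: "\<And>u v. u \<in> ell2 \<Longrightarrow> v \<in> ell2 \<Longrightarrow> ip (T u) v = ip u (T v)"
    and u: "u \<in> ell2" and \<delta>: "0 < \<delta>" "a \<le> E - \<delta>" "E + \<delta> \<le> b"
  shows "l2norm (\<lambda>n. u n - P {a<..<b} u n) \<le> 2 / \<delta> * l2norm (\<lambda>n. T u n - of_real E * u n)"
proof -
  have P: "bounded_pvm P" using S by (simp add: spectral_resolution_def)
  have ab: "a < b" using \<delta> by linarith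
  have U: "UNIV = ({..a} \<union> {b..}) \<union> {a<..<b}" by auto
  have "u = P (({..a} \<union> {b..}) \<union> {a<..<b}) u"
    using pvm_UNIV[OF P u] unfolding U by simp
  also have "\<dots> = (\<lambda>n. P ({..a} \<union> {b..}) u n + P {a<..<b} u n)"
    by (rule pvm_disjoint_Un[OF P u]) auto
  also have "P ({..a} \<union> {b..}) u = (\<lambda>n. P {..a} u n + P {b..} u n)"
    using ab by (intro pvm_disjoint_Un[OF P u]) auto
  finally have "(\<lambda>n. u n - P {a<..<b} u n) = (\<lambda>n. P {..a} u n + P {b..} u n)"
    by (metis (no_types, lifting) add_diff_cancel_right')
  then have "l2norm (\<lambda>n. u n - P {a<..<b} u n) \<le> l2norm (P {..a} u) + l2norm (P {b..} u)"
    using l2norm_triangle[of "P {..a} u" "P {b..} u"] pvm_ell2[OF P _ u] by simp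
  moreover have "\<delta> * l2norm (P {..a} u) \<le> l2norm (\<lambda>n. T u n - of_real E * u n)"
    using \<delta> by (intro spectral_tail_bound[OF S T2 Tlin Tsym u, where s = "-1"]) auto
  moreover have "\<delta> * l2norm (P {b..} u) \<le> l2norm (\<lambda>n. T u n - of_real E * u n)"
    using \<delta> by (intro spectral_tail_bound[OF S T2 Tlin Tsym u, where s = 1]) auto
  ultimately have "\<delta> * l2norm (\<lambda>n. u n - P {a<..<b} u n) \<le> 2 * l2norm (\<lambda>n. T u n - of_real E * u n)"
    using mult_left_mono[of "l2norm (\<lambda>n. u n - P {a<..<b} u n)" "l2norm (P {..a} u) + l2norm (P {b..} u)" \<delta>] \<delta>(1)
    unfolding distrib_left by linarith
  then show ?thesis using \<delta>(1) by (simp add: field_simps)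
qed

section \<open>Tensor products and the commutator\<close>

lemma axis_uminus_int: "axis i (- k) = - axis i (k::int)"
  by (simp add: axis_def vec_eq_iff)

lemma bij_translate: "bij_betw (\<lambda>n. n - a) UNIV (UNIV :: (int ^ 'd::finite) set)"
  by (rule bij_betwI[where g = "\<lambda>n. n + a"]) auto

lemma shift_ell2:
  assumes "u \<in> ell2"
  shows "shift i k u \<in> ell2"
  using assms summable_on_reindex_bij_betw[OF bij_translate[of "axis i k"], of "\<lambda>n. (cmod (u n))\<^sup>2"]
  by (simp add: ell2_def shift_def)

lemma ip_shift: "ip (shift i k u) v = ip u (shift i (- k) v)"
  using infsum_reindex_bij_betw[OF bij_translate[of "axis i k"],
      of "\<lambda>m. cnj (u m) * v (m + axis i k)"]
  by (simp add: ip_def shift_def axis_uminus_int)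

lemma Delta_alt: "Delta i u = (\<lambda>n. (1/2) * (shift i 1 u n + shift i (-1) u n))"
  by (simp add: Delta_def)

lemma Delta_ell2: "u \<in> ell2 \<Longrightarrow> Delta i u \<in> ell2"
  unfolding Delta_alt by (intro ell2_cmult ell2_add shift_ell2)

lemma ip_Delta:
  assumes "u \<in> ell2" "v \<in> ell2"
  shows "ip (Delta i u) v = ip u (Delta i v)"
proof -
  have half: "ip x (\<lambda>n. y n / 2) = ip x y / 2" "ip (\<lambda>n. y n / 2) x = ip y x / 2"
    if "x \<in> ell2" "y \<in> ell2" for x y :: "'a lseq"
    using ip_lin_right[OF that(1) ell2_zero that(2), of "1/2"] ip_lin_left[OF that(1) ell2_zero that(2), of "1/2"]
    by (simp_all add: ip_def)
  show ?thesis unfolding Delta_def using assms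
    by (simp add: half ell2_add shift_ell2 ip_add_left ip_add_right ip_shift add.commute)
qed

lemma Delta_lin: "Delta i (\<lambda>n. u n + c * v n) = (\<lambda>n. Delta i u n + c * Delta i v n)"
  by (simp add: Delta_def shift_def fun_eq_iff algebra_simps add_divide_distrib)

lemma MV_ell2: "u \<in> ell2 \<Longrightarrow> MV (u :: 2 lseq) \<in> ell2"
  unfolding MV_2 by (intro Delta_ell2)

lemma ip_MV: "u \<in> ell2 \<Longrightarrow> v \<in> ell2 \<Longrightarrow> ip (MV (u :: 2 lseq)) v = ip u (MV v)"
proof -
  assume uv: "u \<in> ell2" "v \<in> ell2"
  have "Delta 2 (Delta 1 v) = Delta 1 (Delta 2 v)"
    by (auto simp: Delta_def shift_def fun_eq_iff algebra_simps add_divide_distrib)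
  then show ?thesis unfolding MV_2 using uv by (simp add: ip_Delta Delta_ell2)
qed

lemma MV_lin: "MV (\<lambda>n. u n + c * v n :: complex) = (\<lambda>n. MV (u :: 2 lseq) n + c * MV v n)"
  unfolding MV_2 Delta_lin ..

lemma MV_add: "MV (\<lambda>n. u n + v n :: complex) = (\<lambda>n. MV (u :: 2 lseq) n + MV v n)"
  using MV_lin[of u 1 v] by simp

lemma MV_cmult: "MV (\<lambda>n. c * u n :: complex) = (\<lambda>n. c * MV (u :: 2 lseq) n)"
proof -
  have "MV (\<lambda>n. 0 :: complex) = (\<lambda>n::int^2. 0)" by (simp add: MV_2 Delta_def shift_def)
  then show ?thesis using MV_lin[of "\<lambda>n. 0" c u] by simp
qed

definition tensor :: "(int \<Rightarrow> complex) \<Rightarrow> (int \<Rightarrow> complex) \<Rightarrow> 2 lseq" where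
  "tensor f g = (\<lambda>n. f (n $ 1) * g (n $ 2))"

definition avg :: "(int \<Rightarrow> complex) \<Rightarrow> int \<Rightarrow> complex" where
  "avg f = (\<lambda>m. (f (m - 1) + f (m + 1)) / 2)"

text \<open>The factor in direction \<open>i\<close> of \<open>A_coord p \<kappa> i\<close> on a tensor product, for \<open>k = p \<kappa>\<close>: the
  symmetrized product of \<open>S\<^sup>k - S\<^sup>-\<^sup>k\<close> and the position, divided by \<open>4\<i>\<close>.\<close>

definition dil :: "int \<Rightarrow> (int \<Rightarrow> complex) \<Rightarrow> int \<Rightarrow> complex" where
  "dil k f = (\<lambda>m. (of_int (2 * m - k) * f (m - k) - of_int (2 * m + k) * f (m + k)) / (4 * \<i>))"

text \<open>This is \<open>-(S\<^sup>k - S\<^sup>-\<^sup>k)(S - S\<^sup>-\<^sup>1)/4\<close>, with Fourier symbol \<open>sin \<theta> sin k\<theta>\<close>. In the variable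
  \<open>x = cos \<theta>\<close> this is \<open>(1 - x\<^sup>2) U\<^sub>k\<^sub>-\<^sub>1(x)\<close>.\<close>

definition avg_dil_comm :: "int \<Rightarrow> (int \<Rightarrow> complex) \<Rightarrow> int \<Rightarrow> complex" where
  "avg_dil_comm k f = (\<lambda>m. - (f (m - (k + 1)) - f (m - (k - 1)) - f (m + (k - 1)) + f (m + (k + 1))) / 4)"

lemma Delta_tensor: "Delta 1 (tensor f g) = tensor (avg f) g" "Delta 2 (tensor f g) = tensor f (avg g)"
  by (simp_all add: Delta_def shift_def tensor_def avg_def axis_def fun_eq_iff field_simps)

lemma MV_tensor: "MV (tensor f g) = tensor (avg f) (avg g)"
  by (simp add: MV_2 Delta_tensor)

lemma A_coord_tensor:
  "A_coord p \<kappa> 1 (tensor f g) = tensor (dil (int (p * \<kappa>)) f) g"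
  "A_coord p \<kappa> 2 (tensor f g) = tensor f (dil (int (p * \<kappa>)) g)"
  unfolding A_coord_def shift_def pos_def tensor_def dil_def axis_def
  by (simp_all add: fun_eq_iff field_simps)

lemma A_op_tensor: "A_op p \<kappa> (tensor f g) =
  (\<lambda>n. tensor (dil (int (p * \<kappa>)) f) g n + tensor f (dil (int (p * \<kappa>)) g) n)"
  unfolding A_op_def sum_2 A_coord_tensor ..

lemma avg_dil_commutator: "\<i> * avg (dil k f) m - \<i> * dil k (avg f) m = avg_dil_comm k f m"
  unfolding avg_def dil_def avg_dil_comm_def
  by (simp add: field_simps)

text \<open>The Laplacian is \<open>avg \<otimes> avg\<close> and the conjugate operator is
  \<open>dil k \<otimes> 1 + 1 \<otimes> dil k\<close>, so the commutator acts on one factor at a time.\<close>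

lemma commutator_tensor:
  fixes f g :: "int \<Rightarrow> complex" and p \<kappa> :: nat
  defines "u \<equiv> tensor f g" and "k \<equiv> int (p * \<kappa>)"
  shows "\<i> * MV (A_op p \<kappa> u) n - \<i> * A_op p \<kappa> (MV u) n
    = tensor (avg_dil_comm k f) (avg g) n + tensor (avg f) (avg_dil_comm k g) n"
proof -
  have "\<i> * MV (A_op p \<kappa> u) n - \<i> * A_op p \<kappa> (MV u) n
    = (\<i> * avg (dil k f) (n $ 1) - \<i> * dil k (avg f) (n $ 1)) * avg g (n $ 2)
      + avg f (n $ 1) * (\<i> * avg (dil k g) (n $ 2) - \<i> * dil k (avg g) (n $ 2))"
    unfolding u_def MV_tensor A_op_tensor MV_add k_def by (simp add: tensor_def algebra_simps)
  then show ?thesis unfolding avg_dil_commutator by (simp add: tensor_def)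
qed

text \<open>Finite support of the left factors makes both sides finite sums, whatever the right factors are.\<close>

lemma ip_tensor:
  assumes I: "finite I" and f: "\<And>k. k \<notin> I \<Longrightarrow> f k = 0" and g: "\<And>k. k \<notin> I \<Longrightarrow> g k = 0"
  shows "ip (tensor f g) (tensor f' g') = (\<Sum>k\<in>I. cnj (f k) * f' k) * (\<Sum>k\<in>I. cnj (g k) * g' k)"
proof -
  let ?v = "\<lambda>(a, b). (\<chi> i. if i = 1 then a else b) :: int ^ 2"
  have inj: "inj_on ?v (I \<times> I)" by (auto simp: inj_on_def vec_eq_iff forall_2)
  have "ip (tensor f g) (tensor f' g') = (\<Sum>n\<in>?v ` (I \<times> I). cnj (tensor f g n) * tensor f' g' n)"
  proof (rule ip_finite)
    show "finite (?v ` (I \<times> I))" using I by simp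
    fix n assume n: "n \<notin> ?v ` (I \<times> I)"
    have "n = ?v (n $ 1, n $ 2)" by (simp add: vec_eq_iff forall_2)
    then have "(n $ 1, n $ 2) \<notin> I \<times> I" using n by blast
    then show "tensor f g n = 0" using f g by (auto simp: tensor_def)
  qed
  also have "\<dots> = (\<Sum>(a, b)\<in>I \<times> I. (cnj (f a) * f' a) * (cnj (g b) * g' b))"
    by (subst sum.reindex[OF inj]) (auto simp: tensor_def intro!: sum.cong)
  also have "\<dots> = (\<Sum>k\<in>I. cnj (f k) * f' k) * (\<Sum>k\<in>I. cnj (g k) * g' k)"
    by (simp add: sum_product sum.cartesian_product)
  finally show ?thesis .
qed

lemma tensor_ell_c:
  assumes "finite {k. f k \<noteq> 0}" "finite {k. g k \<noteq> 0}"
  shows "tensor f g \<in> ell_c"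
proof -
  let ?v = "\<lambda>(a, b). (\<chi> i. if i = 1 then a else b) :: int ^ 2"
  have "{n. tensor f g n \<noteq> 0} \<subseteq> ?v ` ({k. f k \<noteq> 0} \<times> {k. g k \<noteq> 0})"
  proof
    fix n :: "int ^ 2" assume "n \<in> {n. tensor f g n \<noteq> 0}"
    then have "(n $ 1, n $ 2) \<in> {k. f k \<noteq> 0} \<times> {k. g k \<noteq> 0}" by (auto simp: tensor_def)
    moreover have "n = ?v (n $ 1, n $ 2)" by (simp add: vec_eq_iff forall_2)
    ultimately show "n \<in> ?v ` ({k. f k \<noteq> 0} \<times> {k. g k \<noteq> 0})" by blast
  qed
  then show ?thesis unfolding ell_c_def using assms
    by (auto intro: finite_subset)
qed


section \<open>Wave packets\<close>

text \<open>The sharp cut-off is chosen because the overlap of the wave with its translates is then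
  exactly computable: translation by \<open>s\<close> multiplies by a phase and loses \<open>\<bar>s\<bar>\<close> of the \<open>R\<close> sites.\<close>

definition wave :: "nat \<Rightarrow> real \<Rightarrow> int \<Rightarrow> complex" where
  "wave R \<theta> k = (if 0 \<le> k \<and> k < int R then cis (of_int k * \<theta>) / of_real (sqrt (real R)) else 0)"

text \<open>The weights of the Fejer mean of order \<open>R\<close>.\<close>

definition fejer :: "nat \<Rightarrow> int \<Rightarrow> real" where
  "fejer R s = max 0 (1 - \<bar>of_int s\<bar> / real R)"

definition expect :: "nat \<Rightarrow> real \<Rightarrow> (int \<Rightarrow> complex) \<Rightarrow> complex" where
  "expect R \<theta> f = (\<Sum>k\<in>{0..<int R}. cnj (wave R \<theta> k) * f k)"

lemma fejer_minus: "fejer R (- s) = fejer R s"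
  by (simp add: fejer_def)

lemma expect_shift:
  assumes R: "R > 0"
  shows "expect R \<theta> (\<lambda>k. wave R \<theta> (k - s)) = of_real (fejer R s) * cis (- of_int s * \<theta>)"
proof -
  let ?J = "{max 0 s..<min (int R) (int R + s)}"
  have "expect R \<theta> (\<lambda>k. wave R \<theta> (k - s)) = (\<Sum>k\<in>?J. cnj (wave R \<theta> k) * wave R \<theta> (k - s))"
    unfolding expect_def by (rule sum.mono_neutral_right) (auto simp: wave_def)
  also have "\<dots> = (\<Sum>k\<in>?J. cis (- of_int s * \<theta>) / of_real (real R))"
  proof (rule sum.cong)
    fix k assume k: "k \<in> ?J"
    have "cnj (wave R \<theta> k) * wave R \<theta> (k - s)
        = (cis (- (of_int k * \<theta>)) * cis (of_int (k - s) * \<theta>)) / (of_real (sqrt (real R)) * of_real (sqrt (real R)))"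
      using k by (simp add: wave_def cis_cnj)
    also have "of_real (sqrt (real R)) * of_real (sqrt (real R)) = complex_of_real (real R)"
      by (simp only: of_real_mult[symmetric]) simp
    also have "cis (- (of_int k * \<theta>)) * cis (of_int (k - s) * \<theta>) = cis (- of_int s * \<theta>)"
      by (simp add: cis_mult algebra_simps)
    finally show "cnj (wave R \<theta> k) * wave R \<theta> (k - s) = cis (- of_int s * \<theta>) / of_real (real R)" .
  qed simp
  also have "\<dots> = of_real (real (nat (int R - \<bar>s\<bar>)) / real R) * cis (- of_int s * \<theta>)"
  proof -
    have "card ?J = nat (int R - \<bar>s\<bar>)" by (simp add: min_def max_def)
    then show ?thesis by simp
  qed
  also have "real (nat (int R - \<bar>s\<bar>)) / real R = fejer R s"
    using R by (auto simp: fejer_def max_def field_simps)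
  finally show ?thesis .
qed

lemma expect_symmetric:
  assumes "R > 0"
  shows "expect R \<theta> (\<lambda>m. of_real a * (wave R \<theta> (m - s) + wave R \<theta> (m + s))
      + of_real b * (wave R \<theta> (m - t) + wave R \<theta> (m + t)))
    = of_real (2 * (a * (fejer R s * cos (of_int s * \<theta>)) + b * (fejer R t * cos (of_int t * \<theta>))))"
proof -
  let ?w = "wave R \<theta>"
  have pair: "expect R \<theta> (\<lambda>m. ?w (m - s)) + expect R \<theta> (\<lambda>m. ?w (m + s))
      = of_real (2 * (fejer R s * cos (of_int s * \<theta>)))" for s
    using expect_shift[OF assms, of \<theta> s] expect_shift[OF assms, of \<theta> "- s"]
    by (simp add: fejer_minus complex_eq_iff)
  have "expect R \<theta> (\<lambda>m. of_real a * (?w (m - s) + ?w (m + s)) + of_real b * (?w (m - t) + ?w (m + t)))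
    = of_real a * (expect R \<theta> (\<lambda>m. ?w (m - s)) + expect R \<theta> (\<lambda>m. ?w (m + s)))
      + of_real b * (expect R \<theta> (\<lambda>m. ?w (m - t)) + expect R \<theta> (\<lambda>m. ?w (m + t)))"
    by (simp add: expect_def sum.distrib sum_distrib_left algebra_simps)
  then show ?thesis unfolding pair by (simp add: algebra_simps)
qed

lemma expect_wave:
  assumes "R > 0"
  shows "expect R \<theta> (wave R \<theta>) = 1"
  using expect_shift[OF assms, of \<theta> 0] by (simp add: fejer_def)

lemma expect_avg:
  assumes "R > 0"
  shows "expect R \<theta> (avg (wave R \<theta>)) = of_real (fejer R 1 * cos \<theta>)"
proof -
  have "avg (wave R \<theta>) = (\<lambda>m. of_real (1/2) * (wave R \<theta> (m - 1) + wave R \<theta> (m + 1))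
      + of_real 0 * (wave R \<theta> (m - 0) + wave R \<theta> (m + 0)))"
    by (simp add: avg_def fun_eq_iff field_simps)
  then show ?thesis by (simp only: expect_symmetric[OF assms]) simp
qed

lemma expect_avg_avg:
  assumes "R > 0"
  shows "expect R \<theta> (avg (avg (wave R \<theta>))) = of_real ((1 + fejer R 2 * cos (2 * \<theta>)) / 2)"
proof -
  have "avg (avg (wave R \<theta>)) = (\<lambda>m. of_real (1/4) * (wave R \<theta> (m - 0) + wave R \<theta> (m + 0))
      + of_real (1/4) * (wave R \<theta> (m - 2) + wave R \<theta> (m + 2)))"
    by (simp add: avg_def fun_eq_iff field_simps)
  then show ?thesis by (simp only: expect_symmetric[OF assms]) (simp add: fejer_def field_simps)
qed

lemma expect_avg_dil_comm:
  assumes "R > 0"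
  shows "expect R \<theta> (avg_dil_comm k (wave R \<theta>)) = of_real
    ((fejer R (k - 1) * cos (of_int (k - 1) * \<theta>) - fejer R (k + 1) * cos (of_int (k + 1) * \<theta>)) / 2)"
proof -
  have "avg_dil_comm k (wave R \<theta>) = (\<lambda>m. of_real (1/4) * (wave R \<theta> (m - (k - 1)) + wave R \<theta> (m + (k - 1)))
      + of_real (-1/4) * (wave R \<theta> (m - (k + 1)) + wave R \<theta> (m + (k + 1))))"
    by (simp add: avg_dil_comm_def fun_eq_iff field_simps)
  then show ?thesis by (simp only: expect_symmetric[OF assms]) (simp add: field_simps)
qed

definition packet :: "nat \<Rightarrow> real \<Rightarrow> real \<Rightarrow> 2 lseq" where
  "packet R \<theta> \<phi> = tensor (wave R \<theta>) (wave R \<phi>)"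

lemma ip_packet: "ip (packet R \<theta> \<phi>) (tensor f g) = expect R \<theta> f * expect R \<phi> g"
  unfolding packet_def expect_def by (rule ip_tensor) (auto simp: wave_def)

lemma finite_supp_wave: "finite {k. wave R \<theta> k \<noteq> 0}"
  by (rule finite_subset[of _ "{0..<int R}"]) (auto simp: wave_def)

lemma finite_supp_avg_wave: "finite {k. avg (wave R \<theta>) k \<noteq> 0}"
  by (rule finite_subset[of _ "{-1..<int R + 1}"]) (auto simp: wave_def avg_def split: if_splits)

lemma packet_ell_c: "packet R \<theta> \<phi> \<in> ell_c"
  unfolding packet_def by (intro tensor_ell_c finite_supp_wave)

lemma packet_norm:
  assumes "R > 0"
  shows "l2norm (packet R \<theta> \<phi>) = 1"
proof -
  have "ip (packet R \<theta> \<phi>) (packet R \<theta> \<phi>) = 1"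
    using ip_packet[of R \<theta> \<phi> "wave R \<theta>" "wave R \<phi>"] expect_wave[OF assms] by (simp add: packet_def)
  then have "(l2norm (packet R \<theta> \<phi>))\<^sup>2 = 1" unfolding ip_self using of_real_eq_1_iff by blast
  then show ?thesis using l2norm_nonneg[of "packet R \<theta> \<phi>"] by (simp add: power2_eq_1_iff)
qed

lemma fejer_lim: "(\<lambda>R. fejer R s) \<longlonglongrightarrow> 1"
proof -
  have "(\<lambda>R. max 0 (1 - \<bar>of_int s\<bar> / real R)) \<longlonglongrightarrow> max 0 (1 - 0)"
    by (intro tendsto_max tendsto_diff tendsto_const lim_const_over_n)
  then show ?thesis by (simp add: fejer_def)
qed

text \<open>The square of the norm is \<open>\<langle>u, MV (MV u)\<rangle> - 2E \<langle>u, MV u\<rangle> + E\<^sup>2\<close>, and both expectations are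
  explicit; as the Fejer weights tend to \<open>1\<close> it tends to \<open>E\<^sup>2 - 2E\<^sup>2 + E\<^sup>2\<close>.\<close>

lemma packet_residual:
  "(\<lambda>R. l2norm (\<lambda>n. MV (packet R \<theta> \<phi>) n - of_real (cos \<theta> * cos \<phi>) * packet R \<theta> \<phi> n)) \<longlonglongrightarrow> 0"
proof -
  define E where "E = cos \<theta> * cos \<phi>"
  define r where "r = (\<lambda>R n. MV (packet R \<theta> \<phi>) n - of_real E * packet R \<theta> \<phi> n)"
  define q where "q = (\<lambda>R. ((1 + fejer R 2 * cos (2 * \<theta>)) / 2) * ((1 + fejer R 2 * cos (2 * \<phi>)) / 2)
      - 2 * E * ((fejer R 1 * cos \<theta>) * (fejer R 1 * cos \<phi>)) + E\<^sup>2)"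
  have sq: "(l2norm (r R))\<^sup>2 = q R" if R: "R > 0" for R
  proof -
    let ?u = "packet R \<theta> \<phi>"
    have u: "?u \<in> ell2" by (intro ell_c_subset_ell2 packet_ell_c)
    have Mu: "MV ?u \<in> ell2" by (rule MV_ell2[OF u])
    have rR: "r R = (\<lambda>n. MV ?u n + (- of_real E) * ?u n)" by (simp add: r_def)
    have 1: "ip (MV ?u) (MV ?u) = of_real (((1 + fejer R 2 * cos (2 * \<theta>)) / 2) * ((1 + fejer R 2 * cos (2 * \<phi>)) / 2))"
    proof -
      have "ip (MV ?u) (MV ?u) = ip ?u (MV (MV ?u))" by (rule ip_MV[OF u Mu])
      also have "MV (MV ?u) = tensor (avg (avg (wave R \<theta>))) (avg (avg (wave R \<phi>)))"
        by (simp add: packet_def MV_tensor)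
      finally show ?thesis by (simp only: ip_packet expect_avg_avg[OF R] of_real_mult)
    qed
    have 2: "ip ?u (MV ?u) = of_real ((fejer R 1 * cos \<theta>) * (fejer R 1 * cos \<phi>))"
    proof -
      have "MV ?u = tensor (avg (wave R \<theta>)) (avg (wave R \<phi>))" by (simp add: packet_def MV_tensor)
      then show ?thesis by (simp only: ip_packet expect_avg[OF R] of_real_mult)
    qed
    have 3: "ip ?u ?u = 1" by (simp add: ip_self packet_norm[OF R])
    have "ip (r R) (r R) = ip (MV ?u) (MV ?u) - of_real E * ip (MV ?u) ?u - of_real E * ip ?u (MV ?u)
        + of_real E * of_real E * ip ?u ?u"
      unfolding rR ip_lin_self[OF Mu u] by (simp add: algebra_simps)
    also have "ip (MV ?u) ?u = ip ?u (MV ?u)" by (rule ip_MV[OF u u])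
    finally have "ip (r R) (r R) = of_real (q R)"
      unfolding 1 2 3 q_def by (simp add: power2_eq_square algebra_simps)
    then show ?thesis unfolding ip_self of_real_eq_iff .
  qed
  have "q \<longlonglongrightarrow> ((1 + 1 * cos (2 * \<theta>)) / 2) * ((1 + 1 * cos (2 * \<phi>)) / 2)
      - 2 * E * ((1 * cos \<theta>) * (1 * cos \<phi>)) + E\<^sup>2"
    unfolding q_def by (intro tendsto_intros fejer_lim) auto
  also have "((1 + 1 * cos (2 * \<theta>)) / 2) * ((1 + 1 * cos (2 * \<phi>)) / 2)
      - 2 * E * ((1 * cos \<theta>) * (1 * cos \<phi>)) + E\<^sup>2 = 0"
    unfolding E_def cos_double_cos by (simp add: power2_eq_square algebra_simps)
  finally have "(\<lambda>R. sqrt (q R)) \<longlonglongrightarrow> sqrt 0" by (intro tendsto_real_sqrt)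
  then have "(\<lambda>R. sqrt (q R)) \<longlonglongrightarrow> 0" by simp
  moreover have "\<forall>\<^sub>F R in sequentially. sqrt (q R) = l2norm (r R)"
    using eventually_gt_at_top[of 0]
    by eventually_elim (simp add: sq[symmetric] l2norm_nonneg)
  ultimately show ?thesis unfolding r_def E_def by (rule Lim_transform_eventually)
qed

section \<open>Combinations of the conjugate operators on tensor products\<close>

lemma finite_supp_dil:
  assumes "finite {m. f m \<noteq> 0}"
  shows "finite {m. dil k f m \<noteq> 0}"
proof (rule finite_subset)
  show "{m. dil k f m \<noteq> 0} \<subseteq> (\<lambda>m. m + k) ` {m. f m \<noteq> 0} \<union> (\<lambda>m. m - k) ` {m. f m \<noteq> 0}"
  proof
    fix m assume "m \<in> {m. dil k f m \<noteq> 0}"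
    then have "f (m - k) \<noteq> 0 \<or> f (m + k) \<noteq> 0" by (auto simp: dil_def)
    moreover have "m = (m - k) + k" "m = (m + k) - k" by simp_all
    ultimately show "m \<in> (\<lambda>m. m + k) ` {m. f m \<noteq> 0} \<union> (\<lambda>m. m - k) ` {m. f m \<noteq> 0}"
      by blast
  qed
qed (use assms in simp)

lemma A_op_tensor_in_ell2:
  assumes "finite {m. f m \<noteq> 0}" "finite {m. g m \<noteq> 0}"
  shows "A_op p \<kappa> (tensor f g) \<in> ell2"
  unfolding A_op_tensor using assms
  by (intro ell2_add ell_c_subset_ell2 tensor_ell_c finite_supp_dil)

text \<open>Norm convergence gives pointwise convergence only between square-summable functions;
  for tensor products of finitely supported sequences the partial sums are again finitely supported.\<close>

lemma comb_graph_pointwise: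
  assumes fg: "finite {m. f m \<noteq> 0}" "finite {m. g m \<noteq> 0}"
    and G: "(tensor f g, v) \<in> comb_graph \<kappa> \<rho>"
  shows "(\<lambda>N. \<Sum>p=1..N. of_real (\<rho> p) * A_op p \<kappa> (tensor f g) n) \<longlonglongrightarrow> v n"
proof -
  let ?s = "\<lambda>N n. \<Sum>p=1..N. of_real (\<rho> p) * A_op p \<kappa> (tensor f g) n"
  have v: "v \<in> ell2" and lim: "(\<lambda>N. l2norm (\<lambda>n. v n - ?s N n)) \<longlonglongrightarrow> 0"
    using G by (auto simp: comb_graph_def)
  have "?s N \<in> ell2" for N
    using ip_sum_right[OF ell2_zero, of "{1..N}" "\<lambda>p n. of_real (\<rho> p) * A_op p \<kappa> (tensor f g) n"]
      A_op_tensor_in_ell2[OF fg] by (simp add: ell2_cmult)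
  then have "(\<lambda>n. v n - ?s N n) \<in> ell2" for N using v by (rule_tac ell2_diff)
  from cmod_le_l2norm[OF this, of n]
  have "(\<lambda>N. v n - ?s N n) \<longlonglongrightarrow> 0"
    by (intro Lim_null_comparison[OF always_eventually lim]) auto
  from tendsto_diff[OF tendsto_const[of "v n"] this] show ?thesis by simp
qed

text \<open>Applied to the delta sequence at the origin, the combination has the value
  \<open>\<rho> p * p\<kappa> / (4\<i>)\<close> at the site \<open>(p\<kappa>, 0)\<close>, because \<open>A_op q \<kappa>\<close> reaches this site only for \<open>q = p\<close>.
  Values of a square-summable function are bounded by its norm.\<close>

lemma comb_coeff_bound:
  assumes sa: "sa_combination \<kappa> \<rho> TYPE(2)" and \<kappa>: "\<kappa> \<ge> 1"
  shows "\<exists>M. \<forall>p\<ge>1. \<bar>\<rho> p\<bar> \<le> M / real p"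
proof -
  define d :: "int \<Rightarrow> complex" where "d = (\<lambda>k. if k = 0 then 1 else 0)"
  have d: "finite {m. d m \<noteq> 0}" by (simp add: d_def)
  have "tensor d d \<in> ell_c" by (intro tensor_ell_c d)
  then obtain v where v: "(tensor d d, v) \<in> comb_graph \<kappa> \<rho>"
    using sa by (auto simp: sa_combination_def)
  then have v2: "v \<in> ell2" by (auto simp: comb_graph_def)
  have "\<bar>\<rho> p\<bar> \<le> 4 * l2norm v / real p" if p: "p \<ge> 1" for p
  proof -
    define n :: "int ^ 2" where "n = axis 1 (int (p * \<kappa>))"
    have n: "n $ 1 = int (p * \<kappa>)" "n $ 2 = 0" by (simp_all add: n_def axis_def)
    have pk: "int (p * \<kappa>) \<noteq> 0" using p \<kappa> by simp
    have A: "A_op q \<kappa> (tensor d d) n = (if q = p then of_int (int (p * \<kappa>)) / (4 * \<i>) else 0)"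
      if "q \<ge> 1" for q
    proof -
      have "int (p * \<kappa>) + int (q * \<kappa>) \<noteq> 0" using pk by linarith
      moreover have "int (p * \<kappa>) - int (q * \<kappa>) = 0 \<longleftrightarrow> q = p" using \<kappa> by auto
      ultimately show ?thesis using pk
        unfolding A_op_tensor unfolding tensor_def dil_def n by (simp add: d_def)
    qed
    have "(\<Sum>q=1..N. of_real (\<rho> q) * A_op q \<kappa> (tensor d d) n)
        = of_real (\<rho> p) * (of_int (int (p * \<kappa>)) / (4 * \<i>))" if "N \<ge> p" for N
    proof -
      have "(\<Sum>q=1..N. of_real (\<rho> q) * A_op q \<kappa> (tensor d d) n)
        = (\<Sum>q\<in>{1..N}. if q = p then of_real (\<rho> p) * (of_int (int (p * \<kappa>)) / (4 * \<i>)) else 0)"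
        by (intro sum.cong) (auto simp: A)
      then show ?thesis using p that by simp
    qed
    then have "\<forall>\<^sub>F N in sequentially. (\<Sum>q=1..N. of_real (\<rho> q) * A_op q \<kappa> (tensor d d) n)
        = of_real (\<rho> p) * (of_int (int (p * \<kappa>)) / (4 * \<i>))"
      by (auto simp: eventually_sequentially)
    from Lim_transform_eventually[OF comb_graph_pointwise[OF d d v] this]
    have "v n = of_real (\<rho> p) * (of_int (int (p * \<kappa>)) / (4 * \<i>))"
      by (simp add: LIMSEQ_const_iff)
    then have "\<bar>\<rho> p\<bar> * (real p * real \<kappa>) / 4 = cmod (v n)"
      by (simp add: norm_mult norm_divide abs_mult)
    also have "\<dots> \<le> l2norm v" by (rule cmod_le_l2norm[OF v2])
    finally have "\<bar>\<rho> p\<bar> * (real p * real \<kappa>) \<le> 4 * l2norm v" by simp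
    moreover have "\<bar>\<rho> p\<bar> * (real p * 1) \<le> \<bar>\<rho> p\<bar> * (real p * real \<kappa>)"
      using \<kappa> by (intro mult_left_mono) auto
    ultimately have "\<bar>\<rho> p\<bar> * real p \<le> 4 * l2norm v" by linarith
    then show ?thesis using p by (simp add: pos_le_divide_eq)
  qed
  then show ?thesis by blast
qed

lemma comb_graph_closure:
  assumes "(u, v) \<in> comb_graph \<kappa> \<rho>"
  shows "(u, v) \<in> graph_closure (comb_graph \<kappa> \<rho>)"
proof -
  have uv: "u \<in> ell2" "v \<in> ell2"
    using assms by (auto simp: comb_graph_def ell_c_subset_ell2)
  have lim: "(\<lambda>k::nat. l2norm (\<lambda>n. x n - x n)) \<longlonglongrightarrow> 0" for x :: "'a lseq"
    by (simp add: l2norm_def)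
  have "\<exists>us vs. (\<forall>k::nat. (us k, vs k) \<in> comb_graph \<kappa> \<rho>) \<and>
      (\<lambda>k. l2norm (\<lambda>n. us k n - u n)) \<longlonglongrightarrow> 0 \<and> (\<lambda>k. l2norm (\<lambda>n. vs k n - v n)) \<longlonglongrightarrow> 0"
    by (rule exI[of _ "\<lambda>k. u"], rule exI[of _ "\<lambda>k. v"]) (use assms lim in blast)
  then show ?thesis using uv unfolding graph_closure_def by blast
qed

lemma MV_tendsto:
  assumes "\<And>m. (\<lambda>N. V N m) \<longlonglongrightarrow> (v :: 2 lseq) m"
  shows "(\<lambda>N. MV (V N) n) \<longlonglongrightarrow> MV v n"
  unfolding MV_2 Delta_def shift_def by (intro tendsto_intros assms) auto

lemma MV_sum:
  assumes "finite I"
  shows "MV (\<lambda>m. \<Sum>p\<in>I. c p * V p m :: complex) n = (\<Sum>p\<in>I. c p * MV (V p :: 2 lseq) n)"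
  using assms MV_cmult[of 0]
  by (induction I rule: finite_induct) (simp_all add: MV_add MV_cmult)

text \<open>The Laplacian involves finitely many sites, hence commutes with pointwise limits. This
  makes \<open>C\<close> the pointwise limit of the commutators with the partial sums, without any
  continuity of the conjugate operator.\<close>

lemma commutator_ext_pointwise:
  assumes sa: "sa_combination \<kappa> \<rho> TYPE(2)"
    and C: "commutator_ext MV (graph_closure (comb_graph \<kappa> \<rho>)) C"
    and fg: "finite {m. f m \<noteq> 0}" "finite {m. g m \<noteq> 0}"
      "finite {m. avg f m \<noteq> 0}" "finite {m. avg g m \<noteq> 0}"
  shows "(\<lambda>N. \<Sum>p=1..N. of_real (\<rho> p) *
      (tensor (avg_dil_comm (int (p * \<kappa>)) f) (avg g) n + tensor (avg f) (avg_dil_comm (int (p * \<kappa>)) g) n))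
    \<longlonglongrightarrow> C (tensor f g) n"
proof -
  let ?u = "tensor f g"
  have u: "?u \<in> ell_c" and Mu: "MV ?u \<in> ell_c"
    unfolding MV_tensor by (intro tensor_ell_c fg)+
  obtain v where v: "(?u, v) \<in> comb_graph \<kappa> \<rho>" using sa u by (auto simp: sa_combination_def)
  obtain w where w: "(MV ?u, w) \<in> comb_graph \<kappa> \<rho>" using sa Mu by (auto simp: sa_combination_def)
  have "C ?u = (\<lambda>n. MV (\<lambda>m. \<i> * v m) n - \<i> * w n)"
    using C u comb_graph_closure[OF v] comb_graph_closure[OF w]
    unfolding commutator_ext_def by blast
  then have Cu: "C ?u n = \<i> * MV v n - \<i> * w n" by (simp add: MV_cmult)
  have "(\<lambda>N. \<i> * MV (\<lambda>m. \<Sum>p=1..N. of_real (\<rho> p) * A_op p \<kappa> ?u m) n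
      - \<i> * (\<Sum>p=1..N. of_real (\<rho> p) * A_op p \<kappa> (MV ?u) n)) \<longlonglongrightarrow> \<i> * MV v n - \<i> * w n"
    using comb_graph_pointwise[OF fg(1,2) v] comb_graph_pointwise[OF fg(3,4) w[unfolded MV_tensor]]
    unfolding MV_tensor[symmetric]
    by (intro tendsto_diff tendsto_mult tendsto_const MV_tendsto)
  moreover have "\<i> * MV (\<lambda>m. \<Sum>p=1..N. of_real (\<rho> p) * A_op p \<kappa> ?u m) n
      - \<i> * (\<Sum>p=1..N. of_real (\<rho> p) * A_op p \<kappa> (MV ?u) n)
    = (\<Sum>p=1..N. of_real (\<rho> p) *
      (tensor (avg_dil_comm (int (p * \<kappa>)) f) (avg g) n + tensor (avg f) (avg_dil_comm (int (p * \<kappa>)) g) n))" for N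
    unfolding commutator_tensor[symmetric] MV_sum[OF finite_atLeastAtMost]
    by (simp add: sum_distrib_left sum_subtractf right_diff_distrib mult.left_commute)
  ultimately show ?thesis unfolding Cu by simp
qed


section \<open>The commutator in a wave packet and Fejer means\<close>

text \<open>The expectation of \<open>avg_dil_comm k\<close> in a wave, as computed in \<open>expect_avg_dil_comm\<close>.\<close>

definition wave_comm :: "nat \<Rightarrow> int \<Rightarrow> real \<Rightarrow> real" where
  "wave_comm R k \<theta> = (fejer R (k - 1) * cos (of_int (k - 1) * \<theta>) - fejer R (k + 1) * cos (of_int (k + 1) * \<theta>)) / 2"

text \<open>The expectation in a packet of the commutator with a single \<open>A_op p \<kappa>\<close>, for \<open>k = p \<kappa>\<close>.\<close>

definition packet_comm :: "nat \<Rightarrow> int \<Rightarrow> real \<Rightarrow> real \<Rightarrow> real" where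
  "packet_comm R k \<theta> \<phi> = wave_comm R k \<theta> * (fejer R 1 * cos \<phi>) + (fejer R 1 * cos \<theta>) * wave_comm R k \<phi>"

lemma fejer_zero: "R > 0 \<Longrightarrow> int R \<le> s \<Longrightarrow> fejer R s = 0"
  by (auto simp: fejer_def max_def field_simps)

lemma wave_comm_zero: "R > 0 \<Longrightarrow> int R < k \<Longrightarrow> wave_comm R k \<theta> = 0"
  by (simp add: wave_comm_def fejer_zero)

lemma fejer_bounds: "0 \<le> fejer R s" "fejer R s \<le> 1"
  by (simp_all add: fejer_def)

lemma fejer_lipschitz:
  assumes "R > 0"
  shows "\<bar>fejer R s - fejer R t\<bar> \<le> \<bar>of_int (s - t)\<bar> / real R"
proof -
  have "\<bar>fejer R s - fejer R t\<bar> \<le> \<bar>(1 - \<bar>of_int s\<bar> / real R) - (1 - \<bar>of_int t\<bar> / real R)\<bar>"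
    unfolding fejer_def by (simp add: max_def abs_if)
  also have "\<dots> = \<bar>\<bar>of_int t\<bar> - \<bar>of_int s\<bar>\<bar> / real R"
    using assms by (simp add: diff_divide_distrib[symmetric] abs_divide)
  also have "\<dots> \<le> \<bar>of_int (s - t)\<bar> / real R"
    by (intro divide_right_mono) auto
  finally show ?thesis .
qed

text \<open>The weights at \<open>k - 1\<close> and \<open>k + 1\<close> differ from the weight at \<open>k\<close> by at most \<open>1/R\<close>; with all
  three equal the product-to-sum formula would give an identity.\<close>

lemma wave_comm_approx:
  assumes R: "R > 0"
  shows "\<bar>wave_comm R k \<theta> - fejer R k * (sin \<theta> * sin (of_int k * \<theta>))\<bar> \<le> 1 / real R"
proof -
  define a b where "a = cos (of_int (k - 1) * \<theta>)" and "b = cos (of_int (k + 1) * \<theta>)"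
  have ss: "sin \<theta> * sin (of_int k * \<theta>) = (a - b) / 2"
    by (simp add: a_def b_def left_diff_distrib distrib_right cos_diff cos_add)
  have "wave_comm R k \<theta> - fejer R k * (sin \<theta> * sin (of_int k * \<theta>))
      = ((fejer R (k - 1) - fejer R k) * a - (fejer R (k + 1) - fejer R k) * b) / 2"
    unfolding wave_comm_def ss a_def[symmetric] b_def[symmetric] by (simp add: field_simps)
  also have "\<bar>\<dots>\<bar> \<le> (\<bar>fejer R (k - 1) - fejer R k\<bar> * \<bar>a\<bar> + \<bar>fejer R (k + 1) - fejer R k\<bar> * \<bar>b\<bar>) / 2"
    using abs_triangle_ineq4 by (simp add: abs_mult[symmetric])
  also have "\<dots> \<le> (1 / real R * 1 + 1 / real R * 1) / 2"
    using fejer_lipschitz[OF R, of "k - 1" k] fejer_lipschitz[OF R, of "k + 1" k]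
    by (intro divide_right_mono add_mono mult_mono) (auto simp: a_def b_def)
  finally show ?thesis by simp
qed

lemma packet_comm_approx:
  assumes R: "R > 0"
  shows "\<bar>packet_comm R k \<theta> \<phi> - fejer R 1 * fejer R k *
      (cos \<phi> * (sin \<theta> * sin (of_int k * \<theta>)) + cos \<theta> * (sin \<phi> * sin (of_int k * \<phi>)))\<bar> \<le> 2 / real R"
proof -
  define a b where "a = fejer R 1 * cos \<phi>" and "b = fejer R 1 * cos \<theta>"
  define x y where "x = wave_comm R k \<theta> - fejer R k * (sin \<theta> * sin (of_int k * \<theta>))"
    and "y = wave_comm R k \<phi> - fejer R k * (sin \<phi> * sin (of_int k * \<phi>))"
  have ab: "\<bar>a\<bar> \<le> 1" "\<bar>b\<bar> \<le> 1"
    using fejer_bounds[of R 1] unfolding a_def b_def abs_mult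
    by (auto intro!: mult_le_one)
  have "packet_comm R k \<theta> \<phi> - fejer R 1 * fejer R k *
      (cos \<phi> * (sin \<theta> * sin (of_int k * \<theta>)) + cos \<theta> * (sin \<phi> * sin (of_int k * \<phi>))) = x * a + b * y"
    by (simp add: packet_comm_def a_def b_def x_def y_def algebra_simps)
  also have "\<bar>\<dots>\<bar> \<le> \<bar>x\<bar> * \<bar>a\<bar> + \<bar>b\<bar> * \<bar>y\<bar>"
    unfolding abs_mult[symmetric] by linarith
  also have "\<dots> \<le> 1 / real R * 1 + 1 * (1 / real R)"
    using wave_comm_approx[OF R] ab unfolding x_def y_def by (intro add_mono mult_mono) auto
  finally show ?thesis by simp
qed

text \<open>For \<open>p > R\<close> the translates by \<open>p\<kappa> - 1\<close> leave the window of the wave, so the limit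
  over the partial sums is reached at \<open>N = R\<close>.\<close>

lemma ip_packet_commutator:
  assumes sa: "sa_combination \<kappa> \<rho> TYPE(2)"
    and C: "commutator_ext MV (graph_closure (comb_graph \<kappa> \<rho>)) C"
    and \<kappa>: "\<kappa> \<ge> 1" and R: "R > 0"
  shows "ip (packet R \<theta> \<phi>) (C (packet R \<theta> \<phi>)) = of_real (\<Sum>p=1..R. \<rho> p * packet_comm R (int (p * \<kappa>)) \<theta> \<phi>)"
proof -
  let ?u = "packet R \<theta> \<phi>"
  let ?D = "\<lambda>p n. tensor (avg_dil_comm (int (p * \<kappa>)) (wave R \<theta>)) (avg (wave R \<phi>)) n
      + tensor (avg (wave R \<theta>)) (avg_dil_comm (int (p * \<kappa>)) (wave R \<phi>)) n"
  define S where "S = {n. ?u n \<noteq> 0}"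
  have S: "finite S" using packet_ell_c[of R \<theta> \<phi>] by (simp add: S_def ell_c_def)
  have ipS: "ip ?u v = (\<Sum>n\<in>S. cnj (?u n) * v n)" for v
    by (rule ip_finite[OF S]) (simp add: S_def)
  have D: "ip ?u (?D p) = of_real (packet_comm R (int (p * \<kappa>)) \<theta> \<phi>)" for p
  proof -
    have "ip ?u (?D p) = ip ?u (tensor (avg_dil_comm (int (p * \<kappa>)) (wave R \<theta>)) (avg (wave R \<phi>)))
      + ip ?u (tensor (avg (wave R \<theta>)) (avg_dil_comm (int (p * \<kappa>)) (wave R \<phi>)))"
      unfolding ipS by (simp add: sum.distrib distrib_left)
    then show ?thesis
      unfolding ip_packet expect_avg[OF R] expect_avg_dil_comm[OF R] wave_comm_def[symmetric]
      by (simp add: packet_comm_def)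
  qed
  have Clim: "(\<lambda>N. \<Sum>p=1..N. of_real (\<rho> p) * ?D p n) \<longlonglongrightarrow> C ?u n" for n
    unfolding packet_def
    by (intro commutator_ext_pointwise[OF sa C] finite_supp_wave finite_supp_avg_wave)
  have "(\<lambda>N. \<Sum>n\<in>S. cnj (?u n) * (\<Sum>p=1..N. of_real (\<rho> p) * ?D p n)) \<longlonglongrightarrow> ip ?u (C ?u)"
    unfolding ipS by (intro tendsto_intros Clim)
  moreover have "(\<Sum>n\<in>S. cnj (?u n) * (\<Sum>p=1..N. of_real (\<rho> p) * ?D p n))
      = of_real (\<Sum>p=1..N. \<rho> p * packet_comm R (int (p * \<kappa>)) \<theta> \<phi>)" for N
  proof -
    have "(\<Sum>n\<in>S. cnj (?u n) * (\<Sum>p=1..N. of_real (\<rho> p) * ?D p n))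
      = (\<Sum>n\<in>S. \<Sum>p=1..N. of_real (\<rho> p) * (cnj (?u n) * ?D p n))"
      by (simp only: sum_distrib_left mult.left_commute)
    also have "\<dots> = (\<Sum>p=1..N. of_real (\<rho> p) * ip ?u (?D p))"
      unfolding ipS by (subst sum.swap) (simp only: sum_distrib_left)
    finally show ?thesis unfolding D by simp
  qed
  ultimately have lim: "(\<lambda>N. complex_of_real (\<Sum>p=1..N. \<rho> p * packet_comm R (int (p * \<kappa>)) \<theta> \<phi>)) \<longlonglongrightarrow> ip ?u (C ?u)"
    by simp
  have stable: "(\<Sum>p=1..N. \<rho> p * packet_comm R (int (p * \<kappa>)) \<theta> \<phi>) = (\<Sum>p=1..R. \<rho> p * packet_comm R (int (p * \<kappa>)) \<theta> \<phi>)"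
    if "N \<ge> R" for N
  proof (rule sum.mono_neutral_right)
    show "\<forall>p\<in>{1..N} - {1..R}. \<rho> p * packet_comm R (int (p * \<kappa>)) \<theta> \<phi> = 0"
    proof
      fix p assume "p \<in> {1..N} - {1..R}"
      then have "R < p" by auto
      also have "p \<le> p * \<kappa>" using \<kappa> by simp
      finally have "int R < int (p * \<kappa>)" by (simp only: of_nat_less_iff)
      then show "\<rho> p * packet_comm R (int (p * \<kappa>)) \<theta> \<phi> = 0" by (simp only: packet_comm_def wave_comm_zero[OF R]) simp
    qed
  qed (use that in auto)
  have "\<forall>\<^sub>F N in sequentially. complex_of_real (\<Sum>p=1..N. \<rho> p * packet_comm R (int (p * \<kappa>)) \<theta> \<phi>)
      = of_real (\<Sum>p=1..R. \<rho> p * packet_comm R (int (p * \<kappa>)) \<theta> \<phi>)"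
    using eventually_ge_at_top[of R] by eventually_elim (rule arg_cong[OF stable])
  from Lim_transform_eventually[OF lim this] show ?thesis by (simp add: LIMSEQ_const_iff)
qed

lemma g_fun_2: "g_fun k (x :: real ^ 2) = x $ 2 * (1 - (x $ 1)\<^sup>2) * cheb_U (k - 1) (x $ 1)
    + x $ 1 * (1 - (x $ 2)\<^sup>2) * cheb_U (k - 1) (x $ 2)"
proof -
  have "(UNIV :: 2 set) - {1} = {2}" "(UNIV :: 2 set) - {2} = {1}"
    unfolding UNIV_2 by auto
  then show ?thesis by (simp add: g_fun_def sum_2)
qed

lemma sin_cheb: "k \<ge> 1 \<Longrightarrow> (1 - (cos t)\<^sup>2) * cheb_U (k - 1) (cos t) = sin t * sin (real k * t)"
  using cheb_U_cos[of "k - 1" t] unfolding sin_squared_eq[symmetric] unfolding power2_eq_square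
  by (simp add: mult_ac)

lemma g_fun_cos:
  assumes "k \<ge> 1" "(x :: real ^ 2) $ 1 = cos \<theta>" "x $ 2 = cos \<phi>"
  shows "g_fun k x = cos \<phi> * (sin \<theta> * sin (real k * \<theta>)) + cos \<theta> * (sin \<phi> * sin (real k * \<phi>))"
  unfolding g_fun_2 assms(2,3) sin_cheb[OF assms(1), symmetric] by simp

lemma S_set_cos:
  assumes "x \<in> S_set E"
  obtains \<theta> \<phi> where "(x :: real ^ 2) $ 1 = cos \<theta>" "x $ 2 = cos \<phi>" "cos \<theta> * cos \<phi> = E"
proof (rule that)
  show "x $ 1 = cos (arccos (x $ 1))" "x $ 2 = cos (arccos (x $ 2))"
    "cos (arccos (x $ 1)) * cos (arccos (x $ 2)) = E"
    using assms by (simp_all add: S_set_def UNIV_2)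
qed

text \<open>The Fejer mean of order \<open>R\<close> of \<open>\<Sum>\<^sub>p \<rho>\<^sub>p g\<^sub>p\<^sub>\<kappa>\<close>; weights with \<open>p > R\<close> vanish for \<open>\<kappa> \<ge> 1\<close>, so the
  sum stops at \<open>R\<close>.\<close>

definition mean_G :: "nat \<Rightarrow> (nat \<Rightarrow> real) \<Rightarrow> nat \<Rightarrow> real ^ 2 \<Rightarrow> real" where
  "mean_G \<kappa> \<rho> R x = (\<Sum>p=1..R. \<rho> p * fejer R (int (p * \<kappa>)) * g_fun (p * \<kappa>) x)"

lemma ln_error_tendsto: "(\<lambda>R. 2 * M / real R * (ln (real R) + 1)) \<longlonglongrightarrow> 0"
proof -
  have "(\<lambda>R. 2 * M * (ln (real R) / real R) + 2 * M / real R) \<longlonglongrightarrow> 2 * M * 0 + 0"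
    by (intro tendsto_intros lim_ln_over_n lim_const_over_n)
  then show ?thesis by (simp add: algebra_simps add_divide_distrib)
qed

text \<open>Each term is off by at most \<open>\<bar>\<rho> p\<bar> * 2 / R \<le> (M / p) * 2 / R\<close>. Summation over \<open>p \<le> R\<close>
  gives a harmonic sum divided by \<open>R\<close>.\<close>

lemma commutator_mean:
  assumes sa: "sa_combination \<kappa> \<rho> TYPE(2)"
    and C: "commutator_ext MV (graph_closure (comb_graph \<kappa> \<rho>)) C"
    and \<kappa>: "\<kappa> \<ge> 1"
    and x: "x $ 1 = cos \<theta>" "x $ 2 = cos \<phi>"
  shows "(\<lambda>R. Re (ip (packet R \<theta> \<phi>) (C (packet R \<theta> \<phi>))) - fejer R 1 * mean_G \<kappa> \<rho> R x) \<longlonglongrightarrow> 0"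
proof -
  obtain M where M: "\<And>p. p \<ge> 1 \<Longrightarrow> \<bar>\<rho> p\<bar> \<le> M / real p"
    using comb_coeff_bound[OF sa \<kappa>] by blast
  have M0: "0 \<le> M" using M[of 1] by simp
  have bound: "\<bar>Re (ip (packet R \<theta> \<phi>) (C (packet R \<theta> \<phi>))) - fejer R 1 * mean_G \<kappa> \<rho> R x\<bar>
      \<le> 2 * M / real R * (ln (real R) + 1)" if R: "R > 0" for R
  proof -
    have "Re (ip (packet R \<theta> \<phi>) (C (packet R \<theta> \<phi>))) - fejer R 1 * mean_G \<kappa> \<rho> R x
      = (\<Sum>p=1..R. \<rho> p * (packet_comm R (int (p * \<kappa>)) \<theta> \<phi> - fejer R 1 * fejer R (int (p * \<kappa>)) * g_fun (p * \<kappa>) x))"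
      unfolding ip_packet_commutator[OF sa C \<kappa> R] mean_G_def
      by (simp add: sum_distrib_left right_diff_distrib sum_subtractf mult_ac)
    also have "\<bar>\<dots>\<bar> \<le> (\<Sum>p=1..R. (M / real p) * (2 / real R))"
    proof (rule order_trans[OF sum_abs], rule sum_mono)
      fix p assume p: "p \<in> {1..R}"
      then have k: "p * \<kappa> \<ge> 1" using \<kappa> by simp
      have "\<bar>packet_comm R (int (p * \<kappa>)) \<theta> \<phi> - fejer R 1 * fejer R (int (p * \<kappa>)) * g_fun (p * \<kappa>) x\<bar> \<le> 2 / real R"
        using packet_comm_approx[OF R, of "int (p * \<kappa>)" \<theta> \<phi>] unfolding g_fun_cos[OF k x] by (simp only: of_int_of_nat_eq)
      then show "\<bar>\<rho> p * (packet_comm R (int (p * \<kappa>)) \<theta> \<phi> - fejer R 1 * fejer R (int (p * \<kappa>)) * g_fun (p * \<kappa>) x)\<bar>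
          \<le> (M / real p) * (2 / real R)"
        unfolding abs_mult using p M M0 by (intro mult_mono) auto
    qed
    also have "\<dots> = 2 * M / real R * harm R"
      by (simp add: harm_def sum_distrib_left field_simps)
    also have "\<dots> \<le> 2 * M / real R * (ln (real R) + 1)"
      using M0 R euler_mascheroni_sequence_decreasing[of 1 R]
      by (intro mult_left_mono) (auto simp: harm_def)
    finally show ?thesis .
  qed
  show ?thesis
    by (rule Lim_null_comparison[OF _ ln_error_tendsto[of M]])
      (use eventually_gt_at_top[of 0] in eventually_elim, use bound in auto)
qed


section \<open>Linear relations exclude the strict estimate\<close>

text \<open>Allows the projected packet in the strict estimate to be replaced by the packet.\<close>

lemma form_perturbation:
  assumes C: "bounded_op C" and u: "u \<in> ell2" and w: "w \<in> ell2"
    and n1: "l2norm u \<le> 1" "l2norm w \<le> 1"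
    and K: "\<And>u. u \<in> ell2 \<Longrightarrow> l2norm (C u) \<le> K * l2norm u" and K0: "0 \<le> K"
  shows "Re (ip w (C w)) \<le> Re (ip u (C u)) + 2 * K * l2norm (\<lambda>n. u n - w n)"
proof -
  let ?v = "\<lambda>n. u n - w n"
  have v: "?v \<in> ell2" by (rule ell2_diff[OF u w])
  have Cu: "C u \<in> ell2" and Cw: "C w \<in> ell2" and Cv: "C ?v \<in> ell2"
    using bounded_op_ell2[OF C] u w v by auto
  have split: "ip u (C u) - ip w (C w) = ip ?v (C u) + ip w (C ?v)"
    unfolding bounded_op_diff[OF C u w] ip_diff_left[OF Cu u w] ip_diff_right[OF w Cu Cw] by simp
  moreover have "cmod (ip ?v (C u)) \<le> K * l2norm ?v"
  proof -
    have "cmod (ip ?v (C u)) \<le> l2norm ?v * l2norm (C u)" by (rule cauchy_schwarz[OF v Cu])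
    also have "\<dots> \<le> l2norm ?v * (K * 1)"
      using K[OF u] mult_left_mono[OF n1(1) K0] by (intro mult_left_mono l2norm_nonneg) linarith
    finally show ?thesis by (simp add: mult.commute)
  qed
  moreover have "cmod (ip w (C ?v)) \<le> K * l2norm ?v"
  proof -
    have "cmod (ip w (C ?v)) \<le> l2norm w * l2norm (C ?v)" by (rule cauchy_schwarz[OF w Cv])
    also have "\<dots> \<le> 1 * (K * l2norm ?v)"
      using K[OF v] n1(2) by (intro mult_mono) (auto simp: l2norm_nonneg)
    finally show ?thesis by simp
  qed
  ultimately have "\<bar>Re (ip u (C u) - ip w (C w))\<bar> \<le> K * l2norm ?v + K * l2norm ?v"
    using abs_Re_le_cmod[of "ip u (C u) - ip w (C w)"] norm_triangle_ineq[of "ip ?v (C u)" "ip w (C ?v)"]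
    unfolding split by linarith
  then show ?thesis by simp
qed

text \<open>Test the estimate on the packets with the frequencies of \<open>x\<close>. They are reproduced by the
  spectral projection up to \<open>e R \<rightarrow> 0\<close>, so \<open>Re \<langle>u, C u\<rangle>\<close> is eventually bounded below by a positive
  constant, and it differs from a positive multiple of the Fejer mean by a null sequence.\<close>

lemma mourre_mean_positive:
  assumes E: "E \<in> mourre_points \<kappa> (MV :: 2 lseq \<Rightarrow> 2 lseq)" and \<kappa>: "\<kappa> \<ge> 1"
  shows "\<exists>\<rho>. \<forall>x\<in>S_set E. \<forall>\<^sub>F R in sequentially. mean_G \<kappa> \<rho> R x > 0"
proof -
  obtain \<rho> a b \<gamma> P C where sa: "sa_combination \<kappa> \<rho> TYPE(2)" and ab: "a < E" "E < b" and \<gamma>: "\<gamma> > 0"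
    and S: "spectral_resolution (MV :: 2 lseq \<Rightarrow> 2 lseq) P"
    and C: "commutator_ext (MV :: 2 lseq \<Rightarrow> 2 lseq) (graph_closure (comb_graph \<kappa> \<rho>)) C"
    and est: "\<And>u. u \<in> ell2 \<Longrightarrow> Re (ip u (P {a<..<b} (C (P {a<..<b} u)))) \<ge> \<gamma> * Re (ip u (P {a<..<b} u))"
    using E unfolding mourre_points_def by blast
  have P: "bounded_pvm P" using S by (simp add: spectral_resolution_def)
  have Cb: "bounded_op C" using C by (simp add: commutator_ext_def)
  obtain K0 where K0: "\<And>u. u \<in> ell2 \<Longrightarrow> l2norm (C u) \<le> K0 * l2norm u"
    using Cb unfolding bounded_op_def by blast
  define K where "K = max 0 K0"
  have K: "0 \<le> K" by (simp add: K_def)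
  have CK: "l2norm (C u) \<le> K * l2norm u" if "u \<in> ell2" for u
    using K0[OF that] mult_right_mono[of K0 K "l2norm u"] by (simp add: K_def l2norm_nonneg)
  define \<delta> where "\<delta> = min (E - a) (b - E)"
  have \<delta>: "0 < \<delta>" "a \<le> E - \<delta>" "E + \<delta> \<le> b" using ab by (auto simp: \<delta>_def)
  have "\<forall>\<^sub>F R in sequentially. mean_G \<kappa> \<rho> R x > 0" if x: "x \<in> S_set E" for x
  proof -
    obtain \<theta> \<phi> where x: "x $ 1 = cos \<theta>" "x $ 2 = cos \<phi>" and EE: "cos \<theta> * cos \<phi> = E"
      using S_set_cos[OF x] by blast
    let ?u = "\<lambda>R. packet R \<theta> \<phi>"
    define e where "e = (\<lambda>R. l2norm (\<lambda>n. ?u R n - P {a<..<b} (?u R) n))"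
    have u: "?u R \<in> ell2" for R by (intro ell_c_subset_ell2 packet_ell_c)
    have "(\<lambda>R. 2 / \<delta> * l2norm (\<lambda>n. MV (?u R) n - of_real E * ?u R n)) \<longlonglongrightarrow> 0"
      using tendsto_mult_right_zero[OF packet_residual[of \<theta> \<phi>]] unfolding EE by blast
    moreover have "\<bar>e R\<bar> \<le> 2 / \<delta> * l2norm (\<lambda>n. MV (?u R) n - of_real E * ?u R n)" for R
      unfolding e_def abs_of_nonneg[OF l2norm_nonneg]
      by (rule spectral_localization[OF S MV_ell2 MV_add ip_MV u \<delta>])
    ultimately have e: "e \<longlonglongrightarrow> 0"
      by (intro Lim_null_comparison[of e]) auto
    have lower: "\<gamma> * (1 - e R) - 2 * K * e R \<le> Re (ip (?u R) (C (?u R)))" if R: "R > 0" for R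
    proof -
      let ?w = "P {a<..<b} (?u R)"
      have w: "?w \<in> ell2" by (rule pvm_ell2[OF P _ u]) simp
      have nu: "l2norm (?u R) = 1" by (rule packet_norm[OF R])
      have nw: "l2norm ?w \<le> 1"
        using orth_projection_norm_le[OF pvm_proj[OF P] u] nu by (metis borel_open open_greaterThanLessThan)
      have "Re (ip (?u R) (?u R)) - Re (ip (?u R) ?w) \<le> l2norm (?u R) * e R"
        using cauchy_schwarz[OF u ell2_diff[OF u w]] complex_Re_le_cmod
        unfolding e_def ip_diff_right[OF u u w] minus_complex.sel(1)[symmetric]
        by (rule order_trans[rotated])
      then have "1 - e R \<le> Re (ip (?u R) ?w)" by (simp add: ip_self nu)
      then have "\<gamma> * (1 - e R) \<le> \<gamma> * Re (ip (?u R) ?w)" using \<gamma> by simp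
      also have "\<dots> \<le> Re (ip (?u R) (P {a<..<b} (C ?w)))" by (rule est[OF u])
      also have "\<dots> = Re (ip ?w (C ?w))"
        using pvm_sym[OF P _ u bounded_op_ell2[OF Cb w], of "{a<..<b}"] by simp
      also have "\<dots> \<le> Re (ip (?u R) (C (?u R))) + 2 * K * e R"
        unfolding e_def using nu nw by (intro form_perturbation[OF Cb u w _ _ CK K]) auto
      finally show ?thesis by simp
    qed
    define r where "r = (\<lambda>R. \<gamma> * (1 - e R) - 2 * K * e R
        - (Re (ip (?u R) (C (?u R))) - fejer R 1 * mean_G \<kappa> \<rho> R x))"
    have "r \<longlonglongrightarrow> \<gamma> * (1 - 0) - 2 * K * 0 - 0"
      unfolding r_def by (intro tendsto_intros e commutator_mean[OF sa C \<kappa> x])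
    then have "\<forall>\<^sub>F R in sequentially. 0 < r R" using \<gamma> by (intro order_tendstoD(1)) auto
    with eventually_gt_at_top[of 0] show ?thesis
    proof eventually_elim
      case (elim R)
      then have "0 < fejer R 1 * mean_G \<kappa> \<rho> R x" using lower[of R] by (simp add: r_def)
      then show ?case using fejer_bounds[of R 1] by (simp add: zero_less_mult_iff)
    qed
  qed
  then show ?thesis by blast
qed

text \<open>The relation holds for each \<open>g_fun (p * \<kappa>)\<close> and therefore for the Fejer mean, a finite
  linear combination of them. At a common large order all means at \<open>x 0, \<dots>, x m\<close> are positive,
  which contradicts the signs of the coefficients.\<close>

lemma Theta_m_not_mourre:
  assumes E: "E \<in> Theta_m TYPE(2) m \<kappa>" and \<kappa>: "\<kappa> \<ge> 1"
  shows "E \<notin> mourre_points \<kappa> (MV :: 2 lseq \<Rightarrow> 2 lseq)"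
proof
  assume "E \<in> mourre_points \<kappa> (MV :: 2 lseq \<Rightarrow> 2 lseq)"
  then obtain \<rho> where \<rho>: "\<And>x. x \<in> S_set E \<Longrightarrow> \<forall>\<^sub>F R in sequentially. mean_G \<kappa> \<rho> R x > 0"
    using mourre_mean_positive[OF _ \<kappa>] by blast
  obtain x :: "nat \<Rightarrow> real ^ 2" and \<omega> :: "nat \<Rightarrow> real" where x: "\<And>q. q \<le> m \<Longrightarrow> x q \<in> S_set E"
    and \<omega>: "\<And>q. q < m \<Longrightarrow> \<omega> q \<le> 0"
    and g: "\<And>p. p \<ge> 1 \<Longrightarrow> g_fun (p * \<kappa>) (x m) = (\<Sum>q<m. \<omega> q * g_fun (p * \<kappa>) (x q))"
    using E unfolding Theta_m_def by blast
  have "\<forall>\<^sub>F R in sequentially. \<forall>q\<in>{..m}. mean_G \<kappa> \<rho> R (x q) > 0"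
    using \<rho> x by (intro eventually_ball_finite) auto
  then obtain R where R: "\<And>q. q \<le> m \<Longrightarrow> mean_G \<kappa> \<rho> R (x q) > 0"
    by (auto simp: eventually_sequentially)
  have "mean_G \<kappa> \<rho> R (x m) = (\<Sum>p=1..R. \<Sum>q<m. \<omega> q * (\<rho> p * fejer R (int (p * \<kappa>)) * g_fun (p * \<kappa>) (x q)))"
    unfolding mean_G_def by (intro sum.cong) (auto simp: g sum_distrib_left mult_ac)
  also have "\<dots> = (\<Sum>q<m. \<omega> q * mean_G \<kappa> \<rho> R (x q))"
    unfolding mean_G_def by (subst sum.swap) (simp only: sum_distrib_left)
  also have "\<dots> \<le> 0"
    using \<omega> R by (intro sum_nonpos mult_nonpos_nonneg) (auto simp: less_imp_le)
  finally show False using R[of m] by simp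
qed

text \<open>A bounded inverse of \<open>MV - E\<close> would bound the norm \<open>1\<close> of the packets by a multiple of
  their residuals, which tend to \<open>0\<close>.\<close>

lemma real_spectrum_MV:
  assumes "-1 \<le> E" "E \<le> 1"
  shows "E \<in> real_spectrum (MV :: 2 lseq \<Rightarrow> 2 lseq)"
  unfolding real_spectrum_def mem_Collect_eq
proof
  assume "\<exists>Q. bounded_op Q \<and> (\<forall>u\<in>ell2. Q (\<lambda>n. MV u n - of_real E * u n) = (u :: 2 lseq) \<and>
      (\<lambda>n. MV (Q u) n - of_real E * Q u n) = u)"
  then obtain Q :: "2 lseq \<Rightarrow> 2 lseq" where Q: "bounded_op Q"
    "\<And>u. u \<in> ell2 \<Longrightarrow> Q (\<lambda>n. MV u n - of_real E * u n) = u" by blast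
  obtain K where K: "\<And>u. u \<in> ell2 \<Longrightarrow> l2norm (Q u) \<le> K * l2norm u"
    using Q(1) unfolding bounded_op_def by blast
  let ?u = "\<lambda>R. packet R (arccos E) 0"
  let ?r = "\<lambda>R n. MV (?u R) n - of_real E * ?u R n"
  have "1 \<le> K * l2norm (?r R)" if R: "R > 0" for R
  proof -
    have u: "?u R \<in> ell2" by (intro ell_c_subset_ell2 packet_ell_c)
    have "?r R \<in> ell2" by (intro ell2_diff MV_ell2 u ell2_cmult)
    from K[OF this] show ?thesis unfolding Q(2)[OF u] packet_norm[OF R] .
  qed
  then have "\<forall>\<^sub>F R in sequentially. 1 \<le> K * l2norm (?r R)"
    by (rule eventually_mono[OF eventually_gt_at_top[of 0]])
  moreover have "(\<lambda>R. K * l2norm (?r R)) \<longlonglongrightarrow> K * 0"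
    using packet_residual[of "arccos E" 0] assms by (intro tendsto_intros) simp
  ultimately have "1 \<le> K * 0" by (intro tendsto_lowerbound) auto
  then show False by simp
qed

lemma Theta_m_subset_Theta:
  assumes "\<kappa> \<ge> 1"
  shows "Theta_m TYPE(2) m \<kappa> \<subseteq> Theta \<kappa> (MV :: 2 lseq \<Rightarrow> 2 lseq)"
  using Theta_m_not_mourre[OF _ assms] real_spectrum_MV
  by (auto simp: Theta_def Theta_m_def)

section \<open>Orbits of a folded interval\<close>

text \<open>Half of a decreasing involution of \<open>[c,a]\<close> with fixed point \<open>b\<close>, namely its branch on \<open>[b,a]\<close>:
  orbits are followed only as long as they stay above \<open>b\<close>.\<close>

locale folding =
  fixes \<sigma> :: "real \<Rightarrow> real" and a b c :: real
  assumes order: "0 < c" "c < b" "b < a"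
    and cont: "continuous_on {b..a} \<sigma>"
    and anti: "\<And>x y. b \<le> x \<Longrightarrow> x < y \<Longrightarrow> y \<le> a \<Longrightarrow> \<sigma> y < \<sigma> x"
    and fix_b: "\<sigma> b = b" and end_a: "\<sigma> a = c"
begin

text \<open>The starting point \<open>F / c = F / \<sigma> a\<close> is itself the image of \<open>a\<close> under \<open>x \<mapsto> F / \<sigma> x\<close>.\<close>

primrec orbit :: "real \<Rightarrow> nat \<Rightarrow> real" where
  "orbit F 0 = F / c"
| "orbit F (Suc r) = F / \<sigma> (orbit F r)"

lemma \<sigma>_ge: "b \<le> x \<Longrightarrow> x \<le> a \<Longrightarrow> c \<le> \<sigma> x"
  using anti[of x a] end_a by (cases "x = a") auto

lemma \<sigma>_pos: "b \<le> x \<Longrightarrow> x \<le> a \<Longrightarrow> 0 < \<sigma> x"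
  using \<sigma>_ge order by force

lemma orbit_top: "orbit (a * c) r = a"
  using order by (induction r) (simp_all add: end_a)

text \<open>For \<open>F < a c\<close> the first step \<open>a \<mapsto> F / c\<close> goes down, and \<open>x \<mapsto> F / \<sigma> x\<close> is increasing, so all
  further steps go down as well.\<close>

lemma orbit_decreasing:
  assumes "0 < F" "F < a * c" "\<And>r. r \<le> m \<Longrightarrow> orbit F r \<in> {b..a}"
  shows "orbit F (Suc m) < orbit F m"
  using assms(3)
proof (induction m)
  case 0
  have "F / c < a" using assms(2) order by (simp add: divide_less_eq)
  then have "c < \<sigma> (F / c)" using anti[of "F / c" a] 0 end_a by auto
  then show ?case using assms(1) order by (simp add: frac_less2)
next
  case (Suc m)
  have less: "orbit F (Suc m) < orbit F m" by (rule Suc.IH) (use Suc.prems in auto)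
  have "\<sigma> (orbit F m) < \<sigma> (orbit F (Suc m))"
    using Suc.prems[of m] Suc.prems[of "Suc m"] by (intro anti less) auto
  moreover have "0 < \<sigma> (orbit F m)" using Suc.prems[of m] by (intro \<sigma>_pos) auto
  ultimately show ?case unfolding orbit.simps(2)[of F "Suc m"] orbit.simps(2)[of F m, symmetric]
    using assms(1) frac_less2[of F F "\<sigma> (orbit F m)" "\<sigma> (orbit F (Suc m))"] by simp
qed

lemma orbit_strict_mono:
  assumes F: "0 < F" "F < F'"
    and "\<And>r. r < m \<Longrightarrow> orbit F r \<in> {b..a}" "\<And>r. r < m \<Longrightarrow> orbit F' r \<in> {b..a}"
  shows "orbit F m < orbit F' m"
  using assms(3,4)
proof (induction m)
  case 0
  then show ?case using F order by (simp add: divide_strict_right_mono)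
next
  case (Suc m)
  have "orbit F m < orbit F' m" by (rule Suc.IH) (use Suc.prems in auto)
  then have "\<sigma> (orbit F' m) \<le> \<sigma> (orbit F m)"
    using Suc.prems(1)[of m] Suc.prems(2)[of m] by (intro less_imp_le[OF anti]) auto
  moreover have "0 < \<sigma> (orbit F' m)" using Suc.prems(2)[of m] by (intro \<sigma>_pos) auto
  ultimately show ?case using F by (auto intro!: frac_less)
qed

lemma orbit_continuous:
  assumes "\<And>F r. F \<in> S \<Longrightarrow> r < m \<Longrightarrow> orbit F r \<in> {b..a}"
  shows "continuous_on S (\<lambda>F. orbit F m)"
  using assms
proof (induction m)
  case 0
  show ?case using order by (auto intro!: continuous_intros)
next
  case (Suc m)
  have in_ba: "(\<lambda>F. orbit F m) ` S \<subseteq> {b..a}" using Suc.prems by blast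
  have "continuous_on S (\<lambda>F. \<sigma> (orbit F m))"
    using Suc by (intro continuous_on_compose2[OF cont _ in_ba]) auto
  moreover have "\<sigma> (orbit F m) \<noteq> 0" if "F \<in> S" for F
    using \<sigma>_pos[of "orbit F m"] Suc.prems[OF that, of m] by auto
  ultimately show ?case by (auto intro!: continuous_intros)
qed

text \<open>At \<open>f\<close> the orbit reaches \<open>b\<close> exactly at time \<open>m\<close>. For larger \<open>F\<close> it is still in \<open>[b,a]\<close> at
  that time, so that its next point is defined and depends continuously on \<open>F\<close>; this second part
  makes the induction over \<open>m\<close> possible.\<close>

definition stage :: "nat \<Rightarrow> real \<Rightarrow> bool" where
  "stage m f \<longleftrightarrow> b * c \<le> f \<and> f < a * c \<and> orbit f m = b \<and> (\<forall>F\<in>{f..a * c}. \<forall>r\<le>m. orbit F r \<in> {b..a})"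

lemma stage_0: "stage 0 (b * c)"
  using order by (auto simp: stage_def pos_le_divide_eq pos_divide_le_eq)

lemma stageD:
  assumes "stage m f"
  shows "0 < f" "f < a * c" "orbit f m = b" "f \<le> F \<Longrightarrow> F \<le> a * c \<Longrightarrow> r \<le> m \<Longrightarrow> orbit F r \<in> {b..a}"
    "b * c \<le> f"
proof -
  have "0 < b * c" using order by simp
  then show "0 < f" using assms unfolding stage_def by linarith
qed (use assms in \<open>auto simp: stage_def\<close>)

text \<open>The orbit also decreases in the step that leaves \<open>b\<close>. Hence \<open>f < b\<^sup>2\<close>, which
  separates \<open>b\<close> from \<open>sqrt f\<close> and decides the signs in the next lemma.\<close>

lemma stage_square:
  assumes "stage m f"
  shows "orbit f (Suc m) = f / b" "f / b < b" "sqrt f < b"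
proof -
  note st = stageD[OF assms]
  show 1: "orbit f (Suc m) = f / b" using st(3) fix_b by simp
  have "orbit f (Suc m) < orbit f m" using st by (intro orbit_decreasing) auto
  then show 2: "f / b < b" unfolding 1 st(3) .
  then have "f < b\<^sup>2" using order by (simp add: pos_divide_less_eq power2_eq_square)
  then show "sqrt f < b" using order by (simp add: real_less_lsqrt st(1) less_imp_le)
qed

text \<open>The point at time \<open>m + 1\<close> moves continuously from below \<open>b\<close> at \<open>F = f\<close> up to \<open>a\<close> at
  \<open>F = a c\<close>, so it equals \<open>b\<close> at some \<open>f'\<close>. Relative to \<open>sqrt F\<close> it is below at \<open>f\<close>, being
  \<open>f / b < sqrt f\<close> there, and above at \<open>f'\<close>, being \<open>b > sqrt f'\<close> there; the crossing is \<open>h\<close>.\<close>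

lemma stage_step:
  assumes st: "stage m f"
  shows "\<exists>h f'. f < h \<and> h < f' \<and> stage (Suc m) f' \<and> orbit h (Suc m) = sqrt h"
proof -
  note D = stageD[OF st]
  have cont_orb: "continuous_on {f..a * c} (\<lambda>F. orbit F (Suc m))"
    using D(4) by (intro orbit_continuous) auto
  have "\<exists>f'\<ge>f. f' \<le> a * c \<and> orbit f' (Suc m) = b"
    using stage_square[OF st] D(2) order orbit_top[of "Suc m"] cont_orb
    by (intro IVT') auto
  then obtain f' where f': "f \<le> f'" "f' \<le> a * c" "orbit f' (Suc m) = b" by blast
  have "f' \<noteq> f" "f' \<noteq> a * c"
    using f'(3) stage_square[OF st] orbit_top[of "Suc m"] order by auto
  then have f'': "f < f'" "f' < a * c" using f' by auto
  have inB: "orbit F (Suc m) \<in> {b..a}" if F: "f' \<le> F" "F \<le> a * c" for F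
  proof -
    have "b \<le> orbit F (Suc m)"
      using orbit_strict_mono[of f' F "Suc m"] D f'' f'(3) F by (cases "F = f'") auto
    moreover have "orbit F (Suc m) \<le> a"
      using orbit_strict_mono[of F "a * c" "Suc m"] D f'' F orbit_top by (cases "F = a * c") (auto simp del: orbit.simps)
    ultimately show ?thesis by simp
  qed
  have st': "stage (Suc m) f'"
    using f'' D f'(3) inB unfolding stage_def by (auto simp: le_Suc_eq simp del: orbit.simps)
  have low: "orbit f (Suc m) - sqrt f < 0"
  proof -
    have "f / b = sqrt f * (sqrt f / b)" using D(1) by simp
    also have "\<dots> < sqrt f * 1"
      using stage_square(3)[OF st] D(1) order by (intro mult_strict_left_mono) auto
    finally show ?thesis unfolding stage_square(1)[OF st] by simp
  qed
  have high: "0 < orbit f' (Suc m) - sqrt f'"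
    using stage_square(3)[OF st'] f'(3) by simp
  have "continuous_on {f..f'} (\<lambda>F. orbit F (Suc m) - sqrt F)"
    using f'' by (intro continuous_intros continuous_on_subset[OF cont_orb]) auto
  then have "\<exists>h\<ge>f. h \<le> f' \<and> orbit h (Suc m) - sqrt h = 0"
    using low high f'' by (intro IVT') (auto simp del: orbit.simps)
  then obtain h where h: "f \<le> h" "h \<le> f'" "orbit h (Suc m) - sqrt h = 0" by blast
  moreover have "h \<noteq> f" "h \<noteq> f'" using h(3) low high by auto
  ultimately show ?thesis using st' by (intro exI[of _ h] exI[of _ f']) auto
qed

lemma stages:
  obtains f h :: "nat \<Rightarrow> real" where "\<And>m. stage m (f m)" "\<And>m. f m < h m" "\<And>m. h m < f (Suc m)"
    "\<And>m. orbit (h m) (Suc m) = sqrt (h m)" "f 0 = b * c"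
proof -
  have "\<exists>f. \<forall>m. (stage m (f m) \<and> (m = 0 \<longrightarrow> f m = b * c)) \<and>
      (\<exists>h. f m < h \<and> h < f (Suc m) \<and> orbit h (Suc m) = sqrt h)"
    by (intro dependent_nat_choice) (use stage_0 stage_step in blast)+
  then obtain f where f: "\<And>m. stage m (f m)" "f 0 = b * c"
    and "\<And>m. \<exists>h. f m < h \<and> h < f (Suc m) \<and> orbit h (Suc m) = sqrt h" by metis
  from this(3) obtain h where "\<And>m. f m < h m \<and> h m < f (Suc m) \<and> orbit (h m) (Suc m) = sqrt (h m)"
    by metis
  then show thesis using f by (intro that[of f h]) auto
qed

text \<open>A solution of the system together with what is lost when \<open>\<sigma>\<close> is replaced by equality of the
  Chebyshev polynomials: the partner \<open>X (n - q)\<close> is the mirror image of \<open>X q\<close>, and for even \<open>n\<close> the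
  unpaired middle entry is the fixed point \<open>b\<close>.\<close>

definition chain :: "nat \<Rightarrow> real \<Rightarrow> (nat \<Rightarrow> real) \<Rightarrow> bool" where
  "chain n F X \<longleftrightarrow> X (n + 1) = c \<and> X 0 < a \<and> (\<forall>q\<le>n. X (q + 1) < X q) \<and>
     (\<forall>q\<le>(n + 1) div 2. X (n + 1 - q) = F / X q) \<and>
     (\<forall>q<(n + 1) div 2. X q \<in> {b..a} \<and> X (n - q) = \<sigma> (X q)) \<and>
     (even n \<longrightarrow> X (n div 2) = b)"

text \<open>The orbit up to its closing time \<open>\<mu>\<close> is reflected by \<open>x \<mapsto> F / x\<close>. For odd \<open>n\<close> the middle entry
  is its own partner, which needs \<open>X \<mu> = sqrt F\<close>. For even \<open>n\<close> the two halves do not overlap,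
  and \<open>F / b < b\<close> gives the strict decrease from one to the other.\<close>

lemma chain_from_orbit:
  assumes F: "0 < F" "F < a * c"
    and n: "n \<ge> 1" and \<mu>: "\<mu> = (n + 1) div 2"
    and inB: "\<And>r. r < \<mu> \<Longrightarrow> orbit F r \<in> {b..a}"
    and last: "if even n then orbit F \<mu> = b \<and> F / b < b else orbit F \<mu> = sqrt F"
  shows "\<exists>X. chain n F X"
proof -
  define X where "X = (\<lambda>q. if q \<le> \<mu> then orbit F q else F / orbit F (n + 1 - q))"
  have \<mu>1: "\<mu> \<ge> 1" using n \<mu> by auto
  have pos: "0 < orbit F r" if "r \<le> \<mu>" for r
  proof (cases "r < \<mu>")
    case True
    then show ?thesis using inB[OF True] order by auto
  next
    case False
    then have "r = \<mu>" using that by simp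
    then show ?thesis using last order F by (auto split: if_splits)
  qed
  have refl: "X (n + 1 - q) = F / X q" if q: "q \<le> \<mu>" for q
  proof (cases "n + 1 - q \<le> \<mu>")
    case True
    then have "odd n" "q = \<mu>" "n + 1 - q = \<mu>" using q \<mu> by presburger+
    then show ?thesis using last F by (simp add: X_def real_div_sqrt)
  next
    case False
    moreover have "n + 1 - (n + 1 - q) = q" using q \<mu> by presburger
    ultimately show ?thesis using q by (simp add: X_def)
  qed
  have dec1: "X (q + 1) < X q" if q: "q < \<mu>" for q
    using orbit_decreasing[OF F, of q] q inB by (simp add: X_def)
  have posX: "0 < X q" if "q \<le> \<mu>" for q using pos[OF that] that by (simp add: X_def)
  have dec: "X (q + 1) < X q" if q: "q \<le> n" for q
  proof -
    have "q < \<mu> \<or> even n \<and> q = \<mu> \<or> q \<ge> \<mu> \<and> n + 1 - q \<le> \<mu>" using \<mu> by presburger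
    then consider "q < \<mu>" | "even n" "q = \<mu>" | "q \<ge> \<mu>" "n + 1 - q \<le> \<mu>" by blast
    then show ?thesis
    proof cases
      case 1
      then show ?thesis by (rule dec1)
    next
      case 2
      then have "q + 1 = n + 1 - q" using \<mu> by presburger
      then have "X (q + 1) = F / X q" using refl[of q] 2 by simp
      moreover have "X q = b" "F / b < b" using 2 last by (simp_all add: X_def)
      ultimately show ?thesis by simp
    next
      case 3
      let ?r = "n - q"
      have r: "?r < \<mu>" "q + 1 = n + 1 - ?r" "q = n + 1 - (?r + 1)" "?r + 1 \<le> \<mu>"
        using 3 q by auto
      have "X (q + 1) = F / X ?r" "X q = F / X (?r + 1)"
        using refl[of ?r] refl[of "?r + 1"] r by (metis less_imp_le)+
      then show ?thesis using dec1[OF r(1)] posX[OF r(4)] F by (simp add: frac_less2)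
    qed
  qed
  have "X (n - q) = \<sigma> (X q)" "X q \<in> {b..a}" if q: "q < \<mu>" for q
  proof -
    have "n - q = n + 1 - (q + 1)" by simp
    then have "X (n - q) = F / X (q + 1)" using refl[of "q + 1"] q by simp
    also have "\<dots> = \<sigma> (X q)"
      using q F \<sigma>_pos[of "orbit F q"] inB[OF q] by (simp add: X_def)
    finally show "X (n - q) = \<sigma> (X q)" .
    show "X q \<in> {b..a}" using inB[OF q] q by (simp add: X_def)
  qed
  moreover have "X (n + 1) = c" using refl[of 0] order F by (simp add: X_def)
  moreover have "X 0 < a" using F order by (simp add: X_def pos_divide_less_eq)
  moreover have "X (n div 2) = b" if "even n"
  proof -
    have "n div 2 = \<mu>" using that \<mu> by presburger
    then show ?thesis using last that by (simp add: X_def)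
  qed
  ultimately have "chain n F X" using dec refl unfolding chain_def \<mu> by blast
  then show ?thesis by (intro exI[of _ X])
qed

text \<open>The energies with even index are those where the orbit meets \<open>b\<close>, the energies with odd
  index those where it meets \<open>sqrt F\<close>. The energy \<open>F 0 = b c\<close> is the endpoint of the interval and
  only starts the induction.\<close>

lemma chain_sequence:
  obtains F :: "nat \<Rightarrow> real" where "\<And>n. F n < F (n + 1)"
    "\<And>n. n \<ge> 1 \<Longrightarrow> b * c < F n \<and> F n < a * c" "\<And>n. n \<ge> 1 \<Longrightarrow> \<exists>X. chain n (F n) X"
proof -
  obtain f h where f: "\<And>m. stage m (f m)" "\<And>m. f m < h m" "\<And>m. h m < f (Suc m)"
    and h: "\<And>m. orbit (h m) (Suc m) = sqrt (h m)" and f0: "f 0 = b * c"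
    by (rule stages) blast
  define F where "F = (\<lambda>n. if even n then f (n div 2) else h (n div 2))"
  have less: "F n < F (n + 1)" for n
    using f(2)[of "n div 2"] f(3)[of "n div 2"] by (auto simp: F_def elim!: oddE)
  have bounds: "b * c < F n \<and> F n < a * c" if n: "n \<ge> 1" for n
  proof
    have "strict_mono F" by (rule strict_monoI_Suc) (use less in simp)
    then have "F 0 < F n" using n by (auto simp: strict_mono_def)
    then show "b * c < F n" by (simp add: F_def f0)
    have "F n < f (Suc (n div 2))"
      using f(2)[of "n div 2"] f(3)[of "n div 2"] by (auto simp: F_def)
    then show "F n < a * c" using stageD(2)[OF f(1)[of "Suc (n div 2)"]] by linarith
  qed
  have "\<exists>X. chain n (F n) X" if n: "n \<ge> 1" for n
  proof -
    have bc: "0 < b * c" using order by simp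
    have pos: "0 < F n" and lt: "F n < a * c" using bounds[OF n] bc by linarith+
    show ?thesis
    proof (rule chain_from_orbit[OF pos lt n refl])
      fix r assume r: "r < (n + 1) div 2"
      have "f (n div 2) \<le> F n" using f(2)[of "n div 2"] by (auto simp: F_def)
      moreover have "r \<le> n div 2" using r by linarith
      ultimately show "orbit (F n) r \<in> {b..a}" using lt by (intro stageD(4)[OF f(1)]) auto
    next
      show "if even n then orbit (F n) ((n + 1) div 2) = b \<and> F n / b < b
          else orbit (F n) ((n + 1) div 2) = sqrt (F n)"
      proof (cases "even n")
        case True
        then have "(n + 1) div 2 = n div 2" by presburger
        then show ?thesis using True stageD(3)[OF f(1)] stage_square(2)[OF f(1)] by (simp add: F_def)
      next
        case False
        then have "(n + 1) div 2 = Suc (n div 2)" by presburger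
        then show ?thesis using False h by (simp only: F_def if_False)
      qed
    qed
  qed
  then show thesis using less bounds by (intro that[of F]) auto
qed

lemma chain_bounds:
  assumes "chain n F X" "q \<le> n + 1"
  shows "0 < X q" "X q < a"
proof -
  have dec: "X (Suc i) \<le> X i" if "i \<le> n" for i
    using assms(1) that unfolding chain_def by (simp add: less_imp_le)
  have "X (n + 1) \<le> X q" using assms(2)
    by (induction rule: inc_induct) (use dec in \<open>auto intro: order_trans\<close>)
  then show "0 < X q" using assms(1) order by (simp add: chain_def)
  have "q \<le> n + 1 \<Longrightarrow> X q \<le> X 0"
    by (induction q) (use dec in \<open>auto intro: order_trans\<close>)
  then show "X q < a" using assms by (simp add: chain_def)
qed

lemma chain_Sigma_system:
  assumes ch: "chain n F X"
    and T: "\<And>x. x \<in> {b..a} \<Longrightarrow> cheb_T \<kappa> (\<sigma> x) = cheb_T \<kappa> x"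
  shows "Sigma_system \<kappa> n F X"
proof -
  let ?\<mu> = "(n + 1) div 2"
  have b: "(if odd n then (int n - 1) div 2 else int n div 2 - 1) = int ?\<mu> - 1"
    by presburger
  have "cheb_T \<kappa> (X (nat q)) = cheb_T \<kappa> (X (nat (int n - q)))" if q: "0 \<le> q" "q \<le> int ?\<mu> - 1" for q
  proof -
    have r: "nat q < ?\<mu>" "nat (int n - q) = n - nat q" using q by linarith+
    then have "X (n - nat q) = \<sigma> (X (nat q))" "X (nat q) \<in> {b..a}"
      using ch unfolding chain_def by blast+
    then show ?thesis unfolding r(2) using T by simp
  qed
  moreover have "X (nat (int n - q)) = F / X (nat (1 + q))" if q: "-1 \<le> q" "q \<le> int ?\<mu> - 1" for q
  proof -
    have "nat (1 + q) \<le> ?\<mu>" "nat (int n - q) = n + 1 - nat (1 + q)" using q by linarith+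
    then show ?thesis using ch unfolding chain_def by metis
  qed
  ultimately show ?thesis unfolding Sigma_system_def Let_def b by blast
qed

end


section \<open>Linear relations along a chain\<close>

text \<open>Forward substitution, with signs: \<open>A p r = (G p r + \<alpha> r * A p (r - 1)) / \<beta> r\<close> has only
  nonnegative coefficients. They are the same for all \<open>p\<close> because \<open>\<alpha>\<close> and \<open>\<beta>\<close> are.\<close>

lemma bidiagonal_solve:
  fixes A G :: "nat \<Rightarrow> nat \<Rightarrow> real"
  assumes pos: "\<And>r. r \<le> m \<Longrightarrow> 0 < \<beta> r" "\<And>r. 1 \<le> r \<Longrightarrow> r \<le> m \<Longrightarrow> 0 \<le> \<alpha> r"
    and G0: "\<And>p. p \<in> P \<Longrightarrow> G p 0 = \<beta> 0 * A p 0"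
    and G: "\<And>p r. p \<in> P \<Longrightarrow> 1 \<le> r \<Longrightarrow> r \<le> m \<Longrightarrow> G p r = \<beta> r * A p r - \<alpha> r * A p (r - 1)"
  shows "\<exists>e. (\<forall>q. 0 \<le> e q) \<and> (\<forall>p\<in>P. A p m = (\<Sum>q<Suc m. e q * G p q))"
  using pos G
proof (induction m)
  case 0
  have "0 < \<beta> 0" using 0(1) by simp
  then show ?case using G0 by (intro exI[of _ "\<lambda>_. 1 / \<beta> 0"]) auto
next
  case (Suc m)
  obtain e where e: "\<And>q. 0 \<le> e q" "\<And>p. p \<in> P \<Longrightarrow> A p m = (\<Sum>q<Suc m. e q * G p q)"
    using Suc.IH Suc.prems by (metis le_Suc_eq)
  let ?k = "\<alpha> (Suc m) / \<beta> (Suc m)"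
  let ?e = "\<lambda>q. if q \<le> m then ?k * e q else 1 / \<beta> (Suc m)"
  have \<beta>: "0 < \<beta> (Suc m)" and \<alpha>: "0 \<le> \<alpha> (Suc m)" using Suc.prems by auto
  have "A p (Suc m) = (\<Sum>q<Suc (Suc m). ?e q * G p q)" if p: "p \<in> P" for p
  proof -
    have "(\<Sum>q<Suc (Suc m). ?e q * G p q) = (\<Sum>q<Suc m. ?k * (e q * G p q)) + G p (Suc m) / \<beta> (Suc m)"
      unfolding sum.lessThan_Suc[of _ "Suc m"] by (intro arg_cong2[of _ _ _ _ "(+)"] sum.cong) auto
    also have "\<dots> = ?k * A p m + G p (Suc m) / \<beta> (Suc m)"
      using e(2)[OF p] by (simp only: sum_distrib_left)
    also have "\<dots> = A p (Suc m)"
      using Suc.prems(3)[OF p, of "Suc m"] \<beta> by (simp add: field_simps)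
    finally show ?thesis ..
  qed
  then show ?case using e(1) \<alpha> \<beta> by (intro exI[of _ ?e]) auto
qed

text \<open>The points are \<open>x r = (X (n + 1 - r), X r)\<close>. In \<open>g_fun (p * \<kappa>) (x r)\<close> the sine at
  \<open>X (n + 1 - r)\<close>, the mirror image of \<open>X (r - 1)\<close>, equals minus the sine at \<open>X (r - 1)\<close>, and it
  vanishes for \<open>r = 0\<close>: a bidiagonal system for the sines. At \<open>r = \<mu>\<close> the sine at \<open>X \<mu>\<close> is zero
  (even \<open>n\<close>) or again minus the sine at \<open>X (\<mu> - 1)\<close> (odd \<open>n\<close>), so only a negative multiple
  of the latter is left.\<close>

lemma Theta_m_of_chain:
  fixes X :: "nat \<Rightarrow> real"
  assumes n: "n \<ge> 1" and \<mu>: "\<mu> = (n + 1) div 2" and \<kappa>: "\<kappa> \<ge> 1"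
    and X: "\<And>q. q \<le> n + 1 \<Longrightarrow> 0 < X q \<and> X q < 1"
    and refl: "\<And>q. q \<le> \<mu> \<Longrightarrow> X (n + 1 - q) = F / X q"
    and odd: "\<And>p q. q < \<mu> \<Longrightarrow> sin (real (p * \<kappa>) * arccos (X (n - q))) = - sin (real (p * \<kappa>) * arccos (X q))"
    and zero: "\<And>p. sin (real (p * \<kappa>) * arccos (X (n + 1))) = 0"
    and mid: "\<And>p. even n \<Longrightarrow> sin (real (p * \<kappa>) * arccos (X \<mu>)) = 0"
  shows "F \<in> Theta_m TYPE(2) \<mu> \<kappa>"
proof -
  define x :: "nat \<Rightarrow> real ^ 2" where "x = (\<lambda>r. \<chi> i. if i = 1 then X (n + 1 - r) else X r)"
  define A where "A = (\<lambda>p q. sin (real (p * \<kappa>) * arccos (X q)))"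
  define s where "s = (\<lambda>q. sin (arccos (X q)))"
  define \<alpha> \<beta> where "\<alpha> = (\<lambda>r. X r * s (n + 1 - r))" and "\<beta> = (\<lambda>r. X (n + 1 - r) * s r)"
  have \<mu>1: "1 \<le> \<mu>" "\<mu> \<le> n + 1" using n \<mu> by auto
  have x12: "x r $ 1 = X (n + 1 - r)" "x r $ 2 = X r" for r by (simp_all add: x_def)
  have s: "0 < s q" if "q \<le> n + 1" for q
    using X[OF that] arccos_lt_bounded[of "X q"] unfolding s_def by (intro sin_gt_zero) auto
  have S: "x r \<in> S_set F" if r: "r \<le> \<mu>" for r
    using X[of r] X[of "n + 1 - r"] refl[OF r] r \<mu>1
    by (auto simp: S_set_def UNIV_2 forall_2 x12)
  have F: "F \<in> {-1..1}"
  proof -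
    have "F = X (n + 1) * X 0" using refl[of 0] X[of 0] by simp
    moreover have "0 \<le> X (n + 1) * X 0" "X (n + 1) * X 0 \<le> 1"
      using X[of 0] X[of "n + 1"] by (auto intro: mult_le_one)
    ultimately show ?thesis by simp
  qed
  have g: "g_fun (p * \<kappa>) (x r) = \<beta> r * A p r + \<alpha> r * A p (n + 1 - r)"
    if "p \<ge> 1" "r \<le> \<mu>" for p r
  proof -
    have k: "p * \<kappa> \<ge> 1" using that \<kappa> by simp
    have c: "X q = cos (arccos (X q))" if "q \<le> n + 1" for q
      using X[OF that] by (subst cos_arccos) auto
    have "g_fun (p * \<kappa>) (x r) = X r * (s (n + 1 - r) * A p (n + 1 - r)) + X (n + 1 - r) * (s r * A p r)"
    proof -
      have le: "n + 1 - r \<le> n + 1" "r \<le> n + 1" using that(2) \<mu>1 by auto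
      show ?thesis
        using g_fun_cos[OF k trans[OF x12(1) c[OF le(1)]] trans[OF x12(2) c[OF le(2)]]]
        unfolding c[OF le(1), symmetric] c[OF le(2), symmetric] A_def s_def .
    qed
    then show ?thesis by (simp add: \<alpha>_def \<beta>_def algebra_simps)
  qed
  have step: "A p (n + 1 - r) = - A p (r - 1)" if "1 \<le> r" "r \<le> \<mu>" for p r
  proof -
    have r: "n + 1 - r = n - (r - 1)" "r - 1 < \<mu>" using that by auto
    show ?thesis unfolding A_def r(1) by (rule odd[OF r(2)])
  qed
  have pos: "0 < \<alpha> r" "0 < \<beta> r" if "r \<le> \<mu>" for r
    using that \<mu>1 X[of r] X[of "n + 1 - r"] s[of r] s[of "n + 1 - r"] by (auto simp: \<alpha>_def \<beta>_def)
  have "\<exists>e. (\<forall>q. 0 \<le> e q) \<and> (\<forall>p\<in>{1..}. A p (\<mu> - 1) = (\<Sum>q<Suc (\<mu> - 1). e q * g_fun (p * \<kappa>) (x q)))"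
  proof (rule bidiagonal_solve[where \<alpha> = \<alpha> and \<beta> = \<beta>])
    show "0 < \<beta> r" if "r \<le> \<mu> - 1" for r using pos that by simp
    show "0 \<le> \<alpha> r" if "1 \<le> r" "r \<le> \<mu> - 1" for r
      by (rule less_imp_le[OF pos(1)]) (use that in linarith)
    show "g_fun (p * \<kappa>) (x 0) = \<beta> 0 * A p 0" if "p \<in> {1..}" for p
      using g[of p 0] zero[of p] that by (simp add: A_def)
    show "g_fun (p * \<kappa>) (x r) = \<beta> r * A p r - \<alpha> r * A p (r - 1)"
      if "p \<in> {1..}" "1 \<le> r" "r \<le> \<mu> - 1" for p r
      using g[of p r] step[of r p] that by simp
  qed
  then obtain e where e: "\<And>q. 0 \<le> e q"
    "\<And>p. p \<ge> 1 \<Longrightarrow> A p (\<mu> - 1) = (\<Sum>q<\<mu>. e q * g_fun (p * \<kappa>) (x q))"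
    using \<mu>1 by auto
  define \<delta> where "\<delta> = (if even n then \<alpha> \<mu> else \<alpha> \<mu> + \<beta> \<mu>)"
  have \<delta>: "0 \<le> \<delta>" using pos[of \<mu>] by (simp add: \<delta>_def)
  have last: "g_fun (p * \<kappa>) (x \<mu>) = - \<delta> * A p (\<mu> - 1)" if p: "p \<ge> 1" for p
  proof (cases "even n")
    case True
    then show ?thesis using g[OF p, of \<mu>] step[of \<mu> p] mid[of p] \<mu>1 by (simp add: \<delta>_def A_def)
  next
    case False
    then have "n + 1 - \<mu> = \<mu>" using \<mu> by presburger
    then have "A p \<mu> = - A p (\<mu> - 1)" using step[of \<mu> p] \<mu>1 by simp
    then show ?thesis using g[OF p, of \<mu>] step[of \<mu> p] \<mu>1 False by (simp add: \<delta>_def algebra_simps)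
  qed
  have rel: "g_fun (p * \<kappa>) (x \<mu>) = (\<Sum>q<\<mu>. (- \<delta> * e q) * g_fun (p * \<kappa>) (x q))" if "p \<ge> 1" for p
    unfolding last[OF that] e(2)[OF that] by (simp add: sum_distrib_left mult.assoc)
  have neg: "- \<delta> * e q \<le> 0" for q using \<delta> e(1)[of q] by simp
  show ?thesis
    unfolding Theta_m_def
    by (intro CollectI conjI exI[of _ x] exI[of _ "\<lambda>q. - \<delta> * e q"] allI impI F S neg rel)
qed


section \<open>The increasing sequence of thresholds\<close>

theorem theorem9p1:
  fixes \<kappa> j :: nat
  assumes "\<kappa> \<ge> 4" and "even \<kappa>"
    and "odd j" and "1 \<le> j" and "j \<le> \<kappa> div 2"
    and interval_nonempty:
      "cos (real j * pi / real \<kappa>) * cos ((real j + 1) * pi / real \<kappa>)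
         < cos ((real j - 1) * pi / real \<kappa>) * cos ((real j + 1) * pi / real \<kappa>)"
  shows "\<exists>F :: nat \<Rightarrow> real.
    (\<forall>n\<ge>1. F n \<in> {cos (real j * pi / real \<kappa>) * cos ((real j + 1) * pi / real \<kappa>)
                     <..< cos ((real j - 1) * pi / real \<kappa>) * cos ((real j + 1) * pi / real \<kappa>)}
                  \<inter> Theta \<kappa> (MV :: 2 lseq \<Rightarrow> 2 lseq)) \<and>
    (\<forall>n\<ge>1. F n < F (n + 1) \<and> F (n + 1) < F (n + 2)) \<and>
    (\<forall>n\<ge>1. F (2 * n - 1) \<in> Theta_m TYPE(2) n \<kappa> \<and> F (2 * n) \<in> Theta_m TYPE(2) n \<kappa>) \<and>
    (\<forall>n\<ge>1. \<exists>X :: nat \<Rightarrow> real.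
       Sigma_system \<kappa> n (F n) X \<and>
       X (n + 1) = cos ((real j + 1) * pi / real \<kappa>) \<and>
       (\<forall>q\<le>n. X (q + 1) < X q) \<and>
       X 0 < cos ((real j - 1) * pi / real \<kappa>))"
proof -
  define t where "t = pi / real \<kappa>"
  define a b c where "a = cos ((real j - 1) * pi / real \<kappa>)" and "b = cos (real j * pi / real \<kappa>)"
    and "c = cos ((real j + 1) * pi / real \<kappa>)"
  have abc: "a = cos ((real j - 1) * t)" "b = cos (real j * t)" "c = cos ((real j + 1) * t)"
    by (simp_all add: a_def b_def c_def t_def)
  have \<kappa>: "\<kappa> \<ge> 1" "real \<kappa> * t = pi" using assms(1) by (simp_all add: t_def)
  have t: "0 < t" using assms(1) by (simp add: t_def)
  have angles: "0 \<le> (real j - 1) * t" "(real j - 1) * t < real j * t"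
    "real j * t < (real j + 1) * t" "(real j + 1) * t \<le> pi"
  proof -
    show "0 \<le> (real j - 1) * t" using assms(4) t by simp
    show "(real j - 1) * t < real j * t" "real j * t < (real j + 1) * t"
      using t by (simp_all add: algebra_simps)
    have "real j + 1 \<le> real \<kappa>" using assms(1,5) by linarith
    then have "(real j + 1) * t \<le> real \<kappa> * t" using t by (intro mult_right_mono) auto
    then show "(real j + 1) * t \<le> pi" using \<kappa> by simp
  qed
  have ba: "b < a" and cb: "c < b"
    unfolding abc using angles by (intro cos_monotone_0_pi; linarith)+
  \<comment> \<open>A nonempty interval forces \<open>c > 0\<close>, since \<open>b < a\<close>.\<close>
  have "c > 0"
  proof (rule ccontr)
    assume "\<not> 0 < c"
    then have "a * c \<le> b * c" using ba by (intro mult_right_mono_neg) auto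
    then show False using interval_nonempty unfolding a_def b_def c_def by linarith
  qed
  \<comment> \<open>Reflection of the angle at \<open>j\<pi>/\<kappa>\<close>.\<close>
  define \<sigma> where "\<sigma> = (\<lambda>x. cos (2 * real j * t - arccos x))"
  have ac_bounds: "(real j - 1) * t \<le> arccos x" "arccos x \<le> real j * t" if x: "b \<le> x" "x \<le> a" for x
  proof -
    have arc: "arccos b = real j * t" "arccos a = (real j - 1) * t"
      unfolding abc using angles by (intro arccos_cos; linarith)+
    have "-1 \<le> b" "a \<le> 1" by (simp_all add: abc)
    then show "(real j - 1) * t \<le> arccos x" "arccos x \<le> real j * t"
      unfolding arc[symmetric] using x ba by (intro arccos_le_arccos; linarith)+
  qed
  have x1: "-1 \<le> x" "x \<le> 1" if x: "b \<le> x" "x \<le> a" for x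
    using x cos_ge_minus_one[of "real j * t"] cos_le_one[of "(real j - 1) * t"] unfolding abc by linarith+
  have arccos_\<sigma>: "arccos (\<sigma> x) = 2 * real j * t - arccos x" if x: "b \<le> x" "x \<le> a" for x
  proof -
    have "(real j + 1) * t = 2 * real j * t - (real j - 1) * t" by (simp add: algebra_simps)
    moreover have "0 \<le> real j * t" using t by simp
    ultimately show ?thesis
      unfolding \<sigma>_def using ac_bounds[OF x] angles(4) by (intro arccos_cos) auto
  qed
  interpret folding \<sigma> a b c
  proof
    show "0 < c" "c < b" "b < a" by fact+
    show "continuous_on {b..a} \<sigma>"
      unfolding \<sigma>_def using x1 by (intro continuous_intros) auto
    show "\<sigma> b = b" "\<sigma> a = c"
      unfolding \<sigma>_def abc using angles by (simp_all add: arccos_cos algebra_simps)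
  next
    fix x y assume xy: "b \<le> x" "x < y" "y \<le> a"
    have "arccos y < arccos x" using xy x1[of x] x1[of y] by (intro arccos_less_arccos) auto
    moreover have "0 \<le> 2 * real j * t - arccos x" "2 * real j * t - arccos y \<le> pi"
    proof -
      have "(real j + 1) * t = 2 * real j * t - (real j - 1) * t" by (simp add: algebra_simps)
      moreover have "0 \<le> real j * t" using t by simp
      ultimately show "0 \<le> 2 * real j * t - arccos x" "2 * real j * t - arccos y \<le> pi"
        using ac_bounds[of x] ac_bounds[of y] xy angles(4) by linarith+
    qed
    ultimately show "\<sigma> y < \<sigma> x" unfolding \<sigma>_def by (intro cos_monotone_0_pi) auto
  qed
  have T: "cheb_T \<kappa> (\<sigma> x) = cheb_T \<kappa> x" if x: "x \<in> {b..a}" for x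
  proof -
    have "cheb_T \<kappa> (\<sigma> x) = cos (real \<kappa> * (2 * real j * t - arccos x))"
      unfolding \<sigma>_def by (rule cheb_T_cos)
    also have "real \<kappa> * (2 * real j * t - arccos x) = real j * (2 * (real \<kappa> * t)) - real \<kappa> * arccos x"
      by (simp add: algebra_simps)
    also have "\<dots> = 2 * real j * pi - real \<kappa> * arccos x" unfolding \<kappa>(2) by (simp add: algebra_simps)
    also have "cos \<dots> = cos (real \<kappa> * arccos x)" unfolding cos_diff cos_2npi sin_2npi by simp
    also have "\<dots> = cheb_T \<kappa> (cos (arccos x))" by (rule cheb_T_cos[symmetric])
    also have "cos (arccos x) = x" using x x1[of x] by (intro cos_arccos) auto
    finally show ?thesis .
  qed
  have sin_mult: "sin (real (p * \<kappa>) * (real i * t)) = 0" for p i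
  proof -
    have eq: "real (p * \<kappa>) * (real i * t) = real (p * i) * (real \<kappa> * t)"
      by (simp add: mult_ac)
    show ?thesis unfolding eq \<kappa>(2) by (rule sin_npi)
  qed
  have sin_\<sigma>: "sin (real (p * \<kappa>) * arccos (\<sigma> x)) = - sin (real (p * \<kappa>) * arccos x)"
    if x: "x \<in> {b..a}" for p x
  proof -
    have "real (p * \<kappa>) * arccos (\<sigma> x) = real (p * j) * (2 * (real \<kappa> * t)) - real (p * \<kappa>) * arccos x"
      using x by (simp add: arccos_\<sigma> algebra_simps)
    also have "\<dots> = 2 * real (p * j) * pi - real (p * \<kappa>) * arccos x"
      unfolding \<kappa>(2) by (simp add: algebra_simps)
    also have "sin \<dots> = - sin (real (p * \<kappa>) * arccos x)" unfolding sin_diff cos_2npi sin_2npi by simp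
    finally show ?thesis .
  qed
  obtain F where less: "\<And>n. F n < F (n + 1)"
    and bounds: "\<And>n. n \<ge> 1 \<Longrightarrow> b * c < F n \<and> F n < a * c"
    and chains: "\<And>n. n \<ge> 1 \<Longrightarrow> \<exists>X. chain n (F n) X"
    by (rule chain_sequence) blast
  have Th: "F n \<in> Theta_m TYPE(2) ((n + 1) div 2) \<kappa>" if n: "n \<ge> 1" for n
  proof -
    obtain X where X: "chain n (F n) X" using chains[OF n] by blast
    have "a \<le> 1" by (simp add: a_def)
    show ?thesis
    proof (rule Theta_m_of_chain[OF n refl \<kappa>(1), of X])
      show "0 < X q \<and> X q < 1" if "q \<le> n + 1" for q
        using chain_bounds[OF X that] \<open>a \<le> 1\<close> by auto
      show "X (n + 1 - q) = F n / X q" if "q \<le> (n + 1) div 2" for q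
        using X that unfolding chain_def by blast
      show "sin (real (p * \<kappa>) * arccos (X (n - q))) = - sin (real (p * \<kappa>) * arccos (X q))"
        if "q < (n + 1) div 2" for p q
      proof -
        have "X (n - q) = \<sigma> (X q)" "X q \<in> {b..a}" using X that unfolding chain_def by blast+
        then show ?thesis using sin_\<sigma> by simp
      qed
      show "sin (real (p * \<kappa>) * arccos (X (n + 1))) = 0" for p
      proof -
        have "X (n + 1) = c" using X unfolding chain_def by blast
        then have "X (n + 1) = cos (real (j + 1) * t)" by (simp add: abc add.commute)
        moreover have "arccos (cos (real (j + 1) * t)) = real (j + 1) * t"
          using angles by (intro arccos_cos) (auto simp: add.commute)
        ultimately show ?thesis using sin_mult[of p "j + 1"] by simp
      qed
      show "sin (real (p * \<kappa>) * arccos (X ((n + 1) div 2))) = 0" if "even n" for p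
      proof -
        have "(n + 1) div 2 = n div 2" using that by presburger
        then have "X ((n + 1) div 2) = b" using X that unfolding chain_def by simp
        then have "X ((n + 1) div 2) = cos (real j * t)" by (simp add: abc)
        moreover have "arccos (cos (real j * t)) = real j * t"
          using angles by (intro arccos_cos) auto
        ultimately show ?thesis using sin_mult by simp
      qed
    qed
  qed
  show ?thesis unfolding a_def[symmetric] b_def[symmetric] c_def[symmetric]
  proof (rule exI[of _ F], intro conjI allI impI)
    fix n :: nat assume n: "n \<ge> 1"
    show "F n \<in> {b * c<..<a * c} \<inter> Theta \<kappa> (MV :: 2 lseq \<Rightarrow> 2 lseq)"
      using bounds[OF n] Th[OF n] Theta_m_subset_Theta[OF \<kappa>(1)] by auto
    show "F n < F (n + 1)" by (rule less)
    show "F (n + 1) < F (n + 2)" using less[of "n + 1"] by simp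
    have "(2 * n - 1 + 1) div 2 = n" "(2 * n + 1) div 2 = n" using n by auto
    then show "F (2 * n - 1) \<in> Theta_m TYPE(2) n \<kappa>" "F (2 * n) \<in> Theta_m TYPE(2) n \<kappa>"
      using Th[of "2 * n - 1"] Th[of "2 * n"] n by auto
    obtain X where X: "chain n (F n) X" using chains[OF n] by blast
    then show "\<exists>X :: nat \<Rightarrow> real. Sigma_system \<kappa> n (F n) X \<and> X (n + 1) = c \<and>
        (\<forall>q\<le>n. X (q + 1) < X q) \<and> X 0 < a"
      using chain_Sigma_system[OF X T] by (auto simp: chain_def intro!: exI[of _ X])
  qed
qed

end
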